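(* Let $\alpha,\beta,\gamma\in(0,1)$ be such that $(\log\beta)/(\log\alpha)\notin\mathbb Q$, define maps on $[0,1]$ by \[ S_1(x)=\alpha x,\qquad S_2(x)=\beta x,\qquad S_3(x)=\gamma x+(1-\gamma), \] and let $F\subseteq[0,1]$ be the attractor of $\{S_1,S_2,S_3\}$. Then $\dim_{\mathrm A}F=1$. Moreover, let $s$ be the unique real solution of $\alpha^s+\beta^s+\gamma^s=1$. If $s<1$, then \[ \dim_{\mathrm L}F=\dim_{\mathrm H}F=\dim_{\mathrm B}F\leq s<1=\dim_{\mathrm A}F, \] and $\alpha,\beta,\gamma\in(0,1)$ with $(\log\beta)/(\log\alpha)\notin\mathbb Q$ can be chosen so that $s$ is arbitrarily small.
   Context: The attractor is the unique non-empty compact set $F$ with $F=S_1(F)\cup S_2(F)\cup S_3(F)$. $\dim_{\mathrm H}$ and $\dim_{\mathrm B}$ are Hausdorff and box dimension. With $N_r(E)$ the smallest number of open sets of diameter at most $r$ needed to cover $E$ and $B(x,R)$ the closed ball, \[ \dim_{\mathrm A}F=\inf\Big\{\alpha:\ \exists\, C,\rho>0 \text{ such that for all } 0<r<R\leq\rho,\ \sup_{x\in F}N_r(B(x,R)\cap F)\leq C (R/r)^{\alpha}\Big\}, \] \[ \dim_{\mathrm L}F=\sup\Big\{\alpha:\ \exists\, C,\rho>0 \text{ such that for all } 0<r<R\leq\rho,\ \inf_{x\in F}N_r(B(x,R)\cap F)\geq C (R/r)^{\alpha}\Big\} \] (here the bound variable $\alpha$ is unrelated to the contraction ratio). *)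

theory Defs
  imports "HOL-Analysis.Analysis"
begin

section \<open>Covering numbers\<close>

text \<open>
  The library's \<^const>\<open>diameter\<close> has no meaningful value on unbounded sets, so every
  condition of the form "diameter at most" is accompanied by \<^const>\<open>bounded\<close>.
  The covering number is infinite when there is no finite cover.
\<close>

definition covering_number :: "real \<Rightarrow> 'a::metric_space set \<Rightarrow> enat" where
  "covering_number r E =
     Inf {enat (card \<U>) | \<U>. finite \<U> \<and> (\<forall>U\<in>\<U>. open U \<and> bounded U \<and> diameter U \<le> r) \<and> E \<subseteq> \<Union>\<U>}"


section \<open>Assouad and lower dimension\<close>

definition assouad_dim :: "'a::metric_space set \<Rightarrow> ereal" where
  "assouad_dim F =
     (INF a \<in> {a::real. \<exists>C>0. \<exists>\<rho>>0. \<forall>r R. 0 < r \<and> r < R \<and> R \<le> \<rho> \<longrightarrow>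
        (SUP x\<in>F. ereal_of_enat (covering_number r (cball x R \<inter> F))) \<le> ereal (C * (R / r) powr a)}.
      ereal a)"

definition lower_dim :: "'a::metric_space set \<Rightarrow> ereal" where
  "lower_dim F =
     (SUP a \<in> {a::real. \<exists>C>0. \<exists>\<rho>>0. \<forall>r R. 0 < r \<and> r < R \<and> R \<le> \<rho> \<longrightarrow>
        (INF x\<in>F. ereal_of_enat (covering_number r (cball x R \<inter> F))) \<ge> ereal (C * (R / r) powr a)}.
      ereal a)"


section \<open>Box dimension\<close>

definition box_ratio :: "'a::metric_space set \<Rightarrow> real \<Rightarrow> ereal" where
  "box_ratio E r =
     (case covering_number r E of enat n \<Rightarrow> ereal (ln (real n) / (- ln r)) | \<infinity> \<Rightarrow> \<infinity>)"

definition lower_box_dim :: "'a::metric_space set \<Rightarrow> ereal" where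
  "lower_box_dim E = Liminf (at_right 0) (box_ratio E)"

definition upper_box_dim :: "'a::metric_space set \<Rightarrow> ereal" where
  "upper_box_dim E = Limsup (at_right 0) (box_ratio E)"


section \<open>Hausdorff dimension\<close>

text \<open>
  The convention is that the zeroth power of the diameter of a non-empty set is 1
  (whereas \<^term>\<open>0 powr 0 = (0::real)\<close> in the library), and that the empty set contributes 0.
\<close>

definition diam_powr :: "real \<Rightarrow> 'a::metric_space set \<Rightarrow> real" where
  "diam_powr s U = (if U = {} then 0 else if s = 0 then 1 else diameter U powr s)"

definition hausdorff_premeasure :: "real \<Rightarrow> real \<Rightarrow> 'a::metric_space set \<Rightarrow> ennreal" where
  "hausdorff_premeasure s \<delta> E =
     (INF U \<in> {U :: nat \<Rightarrow> 'a set. (\<forall>i. bounded (U i) \<and> diameter (U i) \<le> \<delta>) \<and> E \<subseteq> (\<Union>i. U i)}.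
        \<Sum>i. ennreal (diam_powr s (U i)))"

definition hausdorff_measure :: "real \<Rightarrow> 'a::metric_space set \<Rightarrow> ennreal" where
  "hausdorff_measure s E = (SUP \<delta> \<in> {0<..}. hausdorff_premeasure s \<delta> E)"

definition hausdorff_dim :: "'a::metric_space set \<Rightarrow> ereal" where
  "hausdorff_dim E = (INF s \<in> {s::real. 0 \<le> s \<and> hausdorff_measure s E = 0}. ereal s)"


section \<open>The iterated function system\<close>

definition is_attractor :: "'a::topological_space set \<Rightarrow> ('a \<Rightarrow> 'a) set \<Rightarrow> 'a set \<Rightarrow> bool" where
  "is_attractor X \<S> F \<longleftrightarrow> F \<subseteq> X \<and> F \<noteq> {} \<and> compact F \<and> F = (\<Union>S\<in>\<S>. S ` F)"

definition ifs :: "real \<Rightarrow> real \<Rightarrow> real \<Rightarrow> (real \<Rightarrow> real) set" where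
  "ifs \<alpha> \<beta> \<gamma> = {(\<lambda>x. \<alpha> * x), (\<lambda>x. \<beta> * x), (\<lambda>x. \<gamma> * x + (1 - \<gamma>))}"

end

theory Submission
  imports Defs
begin

text \<open>
  Two independent mechanisms are at work.

  The Assouad dimension is forced up at the point 0, the common fixed point of the first two maps. The
  attractor contains 1, hence all products \<^term>\<open>\<alpha> ^ m * \<beta> ^ n\<close>. Because \<^term>\<open>ln \<beta> / ln \<alpha>\<close> is irrational,
  products with integer exponents are dense in the positive reals (\<open>powr_products_dense\<close>), so that finitely
  many of them approximate a grid in the unit interval; multiplication by a power of \<^term>\<open>\<alpha> * \<beta>\<close> moves these
  points into the attractor (\<open>attractor_contains_scaled_grid\<close>). Hence arbitrarily small balls around 0 contain
  almost evenly spaced grids with any number \<^term>\<open>J\<close> of points. Such a ball needs at least \<^term>\<open>J\<close> sets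
  of diameter proportional to its \<^term>\<open>J\<close>-th part (\<open>card_grid_le_of_assouad_bound\<close>), and no exponent below 1
  is compatible with that.

  The other dimensions do not see this, because they only feel that the attractor contains, in every ball centred
  in it, a copy of itself of comparable size (\<open>attractor_has_copies_in_balls\<close>). For compact sets with this
  property, in any metric space, lower, Hausdorff and box dimension agree (\<open>dims_eq_of_copies_in_balls\<close>). The
  equality of lower dimension and lower box dimension is rescaling. The inequality between upper box
  dimension and Hausdorff dimension is Falconer's implicit theorem: if the Hausdorff measure
  in dimension \<^term>\<open>t\<close> vanishes, then a net at scale \<^term>\<open>r\<close> has at most a constant times \<^term>\<open>r powr (- t)\<close>
  points, since the copies near the points of a larger net would be the first level of a separated
  subsystem of positive \<^term>\<open>t\<close>-dimensional measure. The proof of the last point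
  (\<open>separated_copies_sum_ge\<close>) is an induction over finite covers. Finally, the Hausdorff dimension is at
  most \<^term>\<open>s\<close> by the natural covers with images of the unit interval (\<open>hausdorff_dim_attractor_le\<close>).

  The similarity dimension becomes small when all three ratios are small, and an irrational quotient of the
  logarithms can be prescribed at the same time (\<open>small_similarity_dim\<close>).
\<close>

section \<open>Diameters, separated sets and covering numbers\<close>

lemma diameter_le_dist:
  fixes S :: "'a::metric_space set"
  assumes "0 \<le> d" "\<And>x y. x \<in> S \<Longrightarrow> y \<in> S \<Longrightarrow> dist x y \<le> d"
  shows "diameter S \<le> d"
  using assms by (auto simp: diameter_def intro!: cSUP_least)

lemma diameter_ball_le:
  fixes x :: "'a::metric_space"
  assumes "0 \<le> e"
  shows "diameter (ball x e) \<le> 2 * e"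
proof (rule diameter_le_dist)
  fix y z assume "y \<in> ball x e" "z \<in> ball x e"
  then show "dist y z \<le> 2 * e"
    using dist_triangle2[of y z x] by (simp add: dist_commute)
qed (use assms in simp)

lemma covering_number_le:
  assumes "finite \<U>" "\<And>U. U \<in> \<U> \<Longrightarrow> open U \<and> bounded U \<and> diameter U \<le> r" "E \<subseteq> \<Union>\<U>"
  shows "covering_number r E \<le> enat (card \<U>)"
  unfolding covering_number_def using assms by (intro Inf_lower) auto

lemma covering_number_eq_enatE:
  assumes "covering_number r E = enat n"
  obtains \<U> where "finite \<U>" "\<forall>U\<in>\<U>. open U \<and> bounded U \<and> diameter U \<le> r" "E \<subseteq> \<Union>\<U>" "card \<U> = n"
proof -
  let ?X = "{enat (card \<U>) | \<U>. finite \<U> \<and> (\<forall>U\<in>\<U>. open U \<and> bounded U \<and> diameter U \<le> r) \<and> E \<subseteq> \<Union>\<U>}"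
  have "?X \<noteq> {}"
    using assms unfolding covering_number_def by (metis Inf_enat_def enat.distinct(1))
  then have "Inf ?X \<in> ?X" by (meson all_not_in_conv wellorder_InfI)
  then show thesis
    using assms that unfolding covering_number_def by auto
qed

lemma covering_number_mono:
  assumes "E \<subseteq> E'"
  shows "covering_number r E \<le> covering_number r E'"
  unfolding covering_number_def using assms by (intro Inf_superset_mono) blast

text \<open>
  A set of diameter at most \<^term>\<open>r\<close> contains at most one of the points. Covering numbers are
  bounded from below by such points because these can be transported by a map that expands distances, whereas
  an open cover cannot be pulled back along a map that is only defined on the set.
\<close>
lemma card_separated_le_covering_number:
  assumes "finite P" "P \<subseteq> E" "\<And>p q. p \<in> P \<Longrightarrow> q \<in> P \<Longrightarrow> p \<noteq> q \<Longrightarrow> r < dist p q"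
  shows "enat (card P) \<le> covering_number r E"
proof (cases "covering_number r E")
  case (enat n)
  then obtain \<U> where U: "finite \<U>" "\<forall>U\<in>\<U>. open U \<and> bounded U \<and> diameter U \<le> r" "E \<subseteq> \<Union>\<U>" "card \<U> = n"
    by (rule covering_number_eq_enatE)
  then have "\<forall>p\<in>P. \<exists>U\<in>\<U>. p \<in> U" using assms(2) by blast
  then obtain f where f: "\<And>p. p \<in> P \<Longrightarrow> f p \<in> \<U> \<and> p \<in> f p" by metis
  have "inj_on f P"
  proof (rule inj_onI, rule ccontr)
    fix p q assume pq: "p \<in> P" "q \<in> P" "f p = f q" "p \<noteq> q"
    then have "p \<in> f p" "q \<in> f p" using f by metis+
    then have "dist p q \<le> diameter (f p)"
      using f pq U(2) by (intro diameter_bounded_bound) auto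
    also have "\<dots> \<le> r" using f pq U(2) by blast
    finally show False using assms(3)[of p q] pq by simp
  qed
  then have "card P \<le> card \<U>" using f U(1) by (intro card_inj_on_le) auto
  then show ?thesis using U(4) enat by simp
qed simp

lemma covering_number_ge_1:
  assumes "E \<noteq> {}"
  shows "1 \<le> covering_number r E"
proof -
  obtain x where "x \<in> E" using assms by blast
  then show ?thesis
    using card_separated_le_covering_number[of "{x}" E r] by (simp add: one_enat_def)
qed

text \<open>
  Compactness bounds the size of separated sets, and one of largest size is automatically a net. Together with
  the preceding and the following bound it allows covering numbers to be exchanged for cardinalities of
  separated sets, at the price of a constant factor in the scale.
\<close>
lemma separated_net_exists:
  fixes E :: "'a::metric_space set"
  assumes "compact E" "0 < d"
  obtains P where "finite P" "P \<subseteq> E" "\<And>p q. p \<in> P \<Longrightarrow> q \<in> P \<Longrightarrow> p \<noteq> q \<Longrightarrow> d < dist p q"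
    "E \<subseteq> (\<Union>p\<in>P. cball p d)"
proof -
  define sep where "sep P \<longleftrightarrow> finite P \<and> P \<subseteq> E \<and> (\<forall>p\<in>P. \<forall>q\<in>P. p \<noteq> q \<longrightarrow> d < dist p q)" for P
  obtain T where T: "finite T" "E \<subseteq> (\<Union>x\<in>T. ball x (d / 2))"
  proof (rule compactE_image[OF assms(1), of E "\<lambda>x. ball x (d / 2)"])
    show "E \<subseteq> (\<Union>x\<in>E. ball x (d / 2))" using assms(2) by auto
  qed auto
  have "covering_number d E \<le> enat (card ((\<lambda>x. ball x (d / 2)) ` T))"
    using T assms(2) diameter_ball_le[of "d / 2"] by (intro covering_number_le) auto
  then have bound: "card P \<le> card ((\<lambda>x. ball x (d / 2)) ` T)" if "sep P" for P
    using card_separated_le_covering_number[of P E d] that unfolding sep_def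
    by (meson enat_ord_simps(1) order_trans)
  have "sep {}" by (simp add: sep_def)
  then have "\<exists>P. sep P \<and> (\<forall>Q. sep Q \<longrightarrow> card Q \<le> card P)"
    using bound by (intro ex_has_greatest_nat[where b = "Suc (card ((\<lambda>x. ball x (d / 2)) ` T))"])
      (auto simp: less_Suc_eq_le)
  then obtain P where P: "sep P" and max: "\<And>Q. sep Q \<Longrightarrow> card Q \<le> card P" by blast
  have "E \<subseteq> (\<Union>p\<in>P. cball p d)"
  proof
    fix x assume x: "x \<in> E"
    show "x \<in> (\<Union>p\<in>P. cball p d)"
    proof (rule ccontr)
      assume "x \<notin> (\<Union>p\<in>P. cball p d)"
      then have far: "\<forall>p\<in>P. d < dist p x" by auto
      then have "sep (insert x P)" using P x unfolding sep_def by (auto simp: dist_commute)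
      moreover have "x \<notin> P" using far assms(2) by force
      ultimately show False using max[of "insert x P"] P by (simp add: sep_def)
    qed
  qed
  moreover have "finite P" "P \<subseteq> E" using P by (simp_all add: sep_def)
  moreover have "d < dist p q" if "p \<in> P" "q \<in> P" "p \<noteq> q" for p q
    using P that by (simp add: sep_def)
  ultimately show thesis by (rule that[rotated 3])
qed

lemma covering_number_le_card_net:
  fixes E :: "'a::metric_space set"
  assumes "finite P" "E \<subseteq> (\<Union>p\<in>P. cball p d)" "0 < d"
  shows "covering_number (4 * d) E \<le> enat (card P)"
proof -
  have "covering_number (4 * d) E \<le> enat (card ((\<lambda>p. ball p (2 * d)) ` P))"
  proof (rule covering_number_le)
    have "cball p d \<subseteq> ball p (2 * d)" for p :: 'a using assms(3) by auto
    then show "E \<subseteq> \<Union> ((\<lambda>p. ball p (2 * d)) ` P)" using assms(2) by blast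
    fix U assume "U \<in> (\<lambda>p. ball p (2 * d)) ` P"
    then obtain p where "U = ball p (2 * d)" by blast
    then show "open U \<and> bounded U \<and> diameter U \<le> 4 * d"
      using diameter_ball_le[of "2 * d" p] assms(3) by simp
  qed (use assms(1) in simp)
  also have "\<dots> \<le> enat (card P)" using assms(1) by (simp add: card_image_le)
  finally show ?thesis .
qed

section \<open>Box dimension from growth of covering numbers\<close>

text \<open>
  The constant \<^term>\<open>C\<close> contributes \<^term>\<open>ln C / (- ln r)\<close>, which vanishes in the limit.
\<close>
lemma log_ratio_tendsto:
  fixes C a :: real
  assumes "0 < C"
  shows "((\<lambda>r. ereal (ln (C * (1 / r) powr a) / (- ln r))) \<longlongrightarrow> ereal a) (at_right 0)"
proof -
  have "filterlim (\<lambda>r::real. - ln r) at_top (at_right 0)"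
    by (rule filterlim_compose[OF filterlim_uminus_at_top_at_bot ln_at_0])
  then have "((\<lambda>r::real. inverse (- ln r)) \<longlongrightarrow> 0) (at_right 0)"
    by (rule tendsto_inverse_0_at_top)
  then have lim: "((\<lambda>r. ln C * inverse (- ln r) + a) \<longlongrightarrow> ln C * 0 + a) (at_right 0)"
    by (rule tendsto_add[OF tendsto_mult[OF tendsto_const] tendsto_const])
  have "((\<lambda>r. ln (C * (1 / r) powr a) / (- ln r)) \<longlongrightarrow> a) (at_right 0)"
  proof (rule Lim_transform_eventually)
    show "((\<lambda>r. ln C * inverse (- ln r) + a) \<longlongrightarrow> a) (at_right 0)" using lim by simp
    have "\<forall>\<^sub>F r in at_right 0. r \<in> {0<..<1::real}" by (rule eventually_at_right_real) simp
    then show "\<forall>\<^sub>F r in at_right 0. ln C * inverse (- ln r) + a = ln (C * (1 / r) powr a) / (- ln r)"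
    proof eventually_elim
      case (elim r)
      then have "ln (C * (1 / r) powr a) = ln C + a * (- ln r)"
        using assms by (simp add: ln_mult ln_div)
      moreover have "ln r \<noteq> 0" using elim by simp
      ultimately show ?case by (simp only:) (simp add: field_simps)
    qed
  qed
  then show ?thesis by simp
qed

lemma upper_box_dim_le:
  assumes "E \<noteq> {}" "0 < C"
    and "\<forall>\<^sub>F r in at_right 0. ereal_of_enat (covering_number r E) \<le> ereal (C * (1 / r) powr a)"
  shows "upper_box_dim E \<le> ereal a"
proof -
  have "\<forall>\<^sub>F r in at_right 0. r \<in> {0<..<1::real}" by (rule eventually_at_right_real) simp
  with assms(3) have "\<forall>\<^sub>F r in at_right 0. box_ratio E r \<le> ereal (ln (C * (1 / r) powr a) / (- ln r))"
  proof eventually_elim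
    case (elim r)
    then obtain n where n: "covering_number r E = enat n"
      by (cases "covering_number r E") auto
    have "1 \<le> n" using covering_number_ge_1[OF assms(1), of r] n by (simp add: one_enat_def)
    moreover have "real n \<le> C * (1 / r) powr a" using elim n by simp
    ultimately have "ln (real n) \<le> ln (C * (1 / r) powr a)" by (intro ln_mono) auto
    moreover have "0 < - ln r" using elim by simp
    ultimately show ?case unfolding box_ratio_def n by (simp only: enat.case ereal_less_eq divide_right_mono less_imp_le)
  qed
  then have "upper_box_dim E \<le> Limsup (at_right 0) (\<lambda>r. ereal (ln (C * (1 / r) powr a) / (- ln r)))"
    unfolding upper_box_dim_def by (rule Limsup_mono)
  also have "\<dots> = ereal a" by (rule lim_imp_Limsup[OF _ log_ratio_tendsto[OF assms(2)]]) simp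
  finally show ?thesis .
qed

lemma lower_box_dim_ge:
  assumes "0 < C"
    and "\<forall>\<^sub>F r in at_right 0. ereal (C * (1 / r) powr a) \<le> ereal_of_enat (covering_number r E)"
  shows "ereal a \<le> lower_box_dim E"
proof -
  have "\<forall>\<^sub>F r in at_right 0. r \<in> {0<..<1::real}" by (rule eventually_at_right_real) simp
  with assms(2) have "\<forall>\<^sub>F r in at_right 0. ereal (ln (C * (1 / r) powr a) / (- ln r)) \<le> box_ratio E r"
  proof eventually_elim
    case (elim r)
    show ?case
    proof (cases "covering_number r E")
      case (enat n)
      then have "C * (1 / r) powr a \<le> real n" using elim by simp
      moreover have "0 < C * (1 / r) powr a" using elim assms(1) by simp
      ultimately have "ln (C * (1 / r) powr a) \<le> ln (real n)" by (intro ln_mono) auto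
      moreover have "0 < - ln r" using elim by simp
      ultimately show ?thesis unfolding box_ratio_def enat
        by (simp only: enat.case ereal_less_eq divide_right_mono less_imp_le)
    qed (simp add: box_ratio_def)
  qed
  then have "Liminf (at_right 0) (\<lambda>r. ereal (ln (C * (1 / r) powr a) / (- ln r))) \<le> lower_box_dim E"
    unfolding lower_box_dim_def by (rule Liminf_mono)
  moreover have "Liminf (at_right 0) (\<lambda>r. ereal (ln (C * (1 / r) powr a) / (- ln r))) = ereal a"
    by (rule lim_imp_Liminf[OF _ log_ratio_tendsto[OF assms(1)]]) simp
  ultimately show ?thesis by simp
qed

lemma lower_box_dim_le_upper_box_dim: "lower_box_dim E \<le> upper_box_dim E"
  unfolding lower_box_dim_def upper_box_dim_def by (rule Liminf_le_Limsup) simp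

text \<open>
  Fixing the radius \<^term>\<open>R\<close> at its largest value in the defining inequality of the lower dimension leaves a
  growth bound for the covering numbers of the whole set.
\<close>
lemma lower_dim_le_lower_box_dim:
  assumes "F \<noteq> {}"
  shows "lower_dim F \<le> lower_box_dim F"
  unfolding lower_dim_def
proof (rule SUP_least, clarify)
  fix a C \<rho> :: real
  assume "0 < C" "0 < \<rho>" and
    low: "\<forall>r R. 0 < r \<and> r < R \<and> R \<le> \<rho> \<longrightarrow>
      ereal (C * (R / r) powr a) \<le> (INF x\<in>F. ereal_of_enat (covering_number r (cball x R \<inter> F)))"
  obtain x where x: "x \<in> F" using assms by blast
  show "ereal a \<le> lower_box_dim F"
  proof (rule lower_box_dim_ge)
    show "0 < C * \<rho> powr a" using \<open>0 < C\<close> \<open>0 < \<rho>\<close> by simp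
    have "\<forall>\<^sub>F r in at_right 0. r \<in> {0<..<\<rho>}" using \<open>0 < \<rho>\<close> by (rule eventually_at_right_real)
    then show "\<forall>\<^sub>F r in at_right 0. ereal (C * \<rho> powr a * (1 / r) powr a) \<le> ereal_of_enat (covering_number r F)"
    proof eventually_elim
      case (elim r)
      then have "ereal (C * \<rho> powr a * (1 / r) powr a) = ereal (C * (\<rho> / r) powr a)"
        using \<open>0 < \<rho>\<close> by (simp add: powr_divide)
      also have "\<dots> \<le> (INF x\<in>F. ereal_of_enat (covering_number r (cball x \<rho> \<inter> F)))"
        using low elim by simp
      also have "\<dots> \<le> ereal_of_enat (covering_number r (cball x \<rho> \<inter> F))" using x by (rule INF_lower)
      also have "\<dots> \<le> ereal_of_enat (covering_number r F)" by (simp add: covering_number_mono)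
      finally show ?case .
    qed
  qed
qed

section \<open>Hausdorff dimension through finite covers\<close>

lemma diam_powr_eq: "t \<noteq> 0 \<Longrightarrow> diam_powr t U = diameter U powr t"
  by (simp add: diam_powr_def)

text \<open>
  Finite covers are given as lists, so that a set occurring twice contributes twice to the sum; this matters
  for overlapping iterated function systems, where different words may produce the same set.
\<close>
lemma hausdorff_premeasure_le_sum_list:
  assumes "E \<subseteq> \<Union>(set us)" "\<And>U. U \<in> set us \<Longrightarrow> bounded U \<and> diameter U \<le> \<delta>" "0 < t" "0 \<le> \<delta>"
  shows "hausdorff_premeasure t \<delta> E \<le> ennreal (\<Sum>U\<leftarrow>us. diameter U powr t)"
proof -
  define V where "V i = (if i < length us then us ! i else {})" for i
  have "hausdorff_premeasure t \<delta> E \<le> (\<Sum>i. ennreal (diam_powr t (V i)))"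
    unfolding hausdorff_premeasure_def
  proof (rule INF_lower, intro CollectI conjI allI)
    fix i show "bounded (V i)" "diameter (V i) \<le> \<delta>"
      using assms(2)[of "us ! i"] assms(4) by (auto simp: V_def)
  next
    show "E \<subseteq> (\<Union>i. V i)"
    proof
      fix x assume "x \<in> E"
      then obtain U where "U \<in> set us" "x \<in> U" using assms(1) by blast
      then obtain i where "i < length us" "us ! i = U" by (auto simp: in_set_conv_nth)
      then show "x \<in> (\<Union>i. V i)" using \<open>x \<in> U\<close> by (auto simp: V_def intro!: exI[of _ i])
    qed
  qed
  also have "\<dots> = (\<Sum>i<length us. ennreal (diam_powr t (V i)))"
    by (rule suminf_finite) (auto simp: V_def diam_powr_def)
  also have "\<dots> = (\<Sum>i<length us. ennreal (diameter (us ! i) powr t))"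
    using assms(3) by (intro sum.cong) (auto simp: V_def diam_powr_eq)
  also have "\<dots> = ennreal (\<Sum>i<length us. diameter (us ! i) powr t)"
    by (rule sum_ennreal) simp
  also have "(\<Sum>i<length us. diameter (us ! i) powr t) = (\<Sum>U\<leftarrow>us. diameter U powr t)"
    by (simp add: sum_list_sum_nth atLeast0LessThan)
  finally show ?thesis .
qed

lemma hausdorff_measure_eq_0I:
  assumes "0 < t"
    and "\<And>\<delta> e. 0 < \<delta> \<Longrightarrow> 0 < e \<Longrightarrow> \<exists>us. E \<subseteq> \<Union>(set us) \<and> (\<forall>U\<in>set us. bounded U \<and> diameter U \<le> \<delta>) \<and>
      (\<Sum>U\<leftarrow>us. diameter U powr t) \<le> e"
  shows "hausdorff_measure t E = 0"
proof -
  have "hausdorff_premeasure t \<delta> E \<le> 0" if "0 < \<delta>" for \<delta>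
  proof (rule ennreal_le_epsilon)
    fix e :: real assume "0 < e"
    with assms(2)[OF that this] obtain us where us: "E \<subseteq> \<Union>(set us)"
      "\<forall>U\<in>set us. bounded U \<and> diameter U \<le> \<delta>" "(\<Sum>U\<leftarrow>us. diameter U powr t) \<le> e" by blast
    have "hausdorff_premeasure t \<delta> E \<le> ennreal (\<Sum>U\<leftarrow>us. diameter U powr t)"
      using us that assms(1) by (intro hausdorff_premeasure_le_sum_list) auto
    also have "\<dots> \<le> 0 + ennreal e" using us(3) by (simp add: ennreal_leI)
    finally show "hausdorff_premeasure t \<delta> E \<le> 0 + ennreal e" .
  qed
  then have "hausdorff_measure t E \<le> 0" unfolding hausdorff_measure_def by (intro SUP_least) simp
  then show ?thesis by simp
qed

lemma hausdorff_dim_le: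
  assumes "0 \<le> s" "hausdorff_measure s E = 0"
  shows "hausdorff_dim E \<le> ereal s"
  unfolding hausdorff_dim_def using assms by (intro INF_lower) simp

text \<open>
  If \<^term>\<open>lower_box_dim F < ereal a\<close> and \<^term>\<open>a < b\<close>, then at arbitrarily small scales \<^term>\<open>r\<close> fewer than
  \<^term>\<open>r powr (- a)\<close> sets of diameter at most \<^term>\<open>r\<close> cover the set, and their contribution of
  at most \<^term>\<open>r powr (b - a)\<close> to the \<^term>\<open>b\<close>-dimensional sum is as small as desired.
\<close>
lemma hausdorff_dim_le_lower_box_dim:
  fixes F :: "'a::metric_space set"
  assumes "F \<noteq> {}"
  shows "hausdorff_dim F \<le> lower_box_dim F"
proof (rule dense_ge)
  fix z assume "lower_box_dim F < z"
  then obtain b where b: "lower_box_dim F < ereal b" "ereal b < z" using ereal_dense2 by blast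
  then obtain a where a: "lower_box_dim F < ereal a" "a < b" using ereal_dense2 less_ereal.simps(1) by metis
  have "ereal 0 \<le> lower_box_dim F"
  proof (rule lower_box_dim_ge[of 1])
    have "ereal (1 * (1 / r) powr 0) \<le> ereal_of_enat (covering_number r F)" for r :: real
      using covering_number_ge_1[OF assms, of r] by (cases "covering_number r F") (auto simp: one_enat_def)
    then show "\<forall>\<^sub>F r in at_right 0. ereal (1 * (1 / r) powr 0) \<le> ereal_of_enat (covering_number r F)"
      by simp
  qed simp
  then have "0 < a" using a(1) by (metis ereal_less(2) order_le_less_trans zero_ereal_def)
  then have "0 < b" using a(2) by simp
  have freq: "\<exists>\<^sub>F r in at_right 0. box_ratio F r < ereal a"
  proof (rule ccontr)
    assume "\<not> (\<exists>\<^sub>F r in at_right 0. box_ratio F r < ereal a)"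
    then have "\<forall>\<^sub>F r in at_right 0. ereal a \<le> box_ratio F r" by (simp add: not_frequently not_less)
    then have "ereal a \<le> lower_box_dim F" unfolding lower_box_dim_def by (rule Liminf_bounded)
    then show False using a(1) by simp
  qed
  have "hausdorff_measure b F = 0"
  proof (rule hausdorff_measure_eq_0I[OF \<open>0 < b\<close>])
    fix \<delta> e :: real assume "0 < \<delta>" "0 < e"
    \<comment> \<open>The last bound on the scale makes \<^term>\<open>r powr (b - a) \<le> e\<close>.\<close>
    let ?m = "min (min \<delta> 1) (e powr (1 / (b - a)))"
    have "0 < ?m" using \<open>0 < \<delta>\<close> \<open>0 < e\<close> by simp
    then have "\<forall>\<^sub>F r in at_right 0. r \<in> {0<..<?m}" by (rule eventually_at_right_real)
    from frequently_ex[OF frequently_eventually_conj[OF freq this]]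
    obtain r where "box_ratio F r < ereal a" "r \<in> {0<..<?m}" by blast
    then have r: "box_ratio F r < ereal a" "0 < r" "r < \<delta>" "r < 1" "r < e powr (1 / (b - a))" by auto
    then obtain n where n: "covering_number r F = enat n" "ln (real n) / (- ln r) < a"
      unfolding box_ratio_def by (cases "covering_number r F") auto
    then obtain \<U> where U: "finite \<U>" "\<forall>U\<in>\<U>. open U \<and> bounded U \<and> diameter U \<le> r" "F \<subseteq> \<Union>\<U>" "card \<U> = n"
      by (elim covering_number_eq_enatE)
    obtain us where us: "set us = \<U>" "length us = n"
      using finite_distinct_list[OF U(1)] distinct_card U(4) by metis
    have "0 < n" using covering_number_ge_1[OF assms, of r] n(1) by (simp add: one_enat_def)
    have "0 < - ln r" using r by simp
    then have "ln (real n) < - a * ln r" using n(2) by (simp add: field_simps)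
    then have "ln (real n) < ln (r powr (- a))" using r(2) by simp
    then have "real n < r powr (- a)" using r(2) \<open>0 < n\<close> by (subst (asm) ln_less_cancel_iff) auto
    have "(\<Sum>U\<leftarrow>us. diameter U powr b) \<le> (\<Sum>U\<leftarrow>us. r powr b)"
    proof (rule sum_list_mono)
      fix U assume "U \<in> set us"
      then have "bounded U" "diameter U \<le> r" using us U(2) by auto
      then show "diameter U powr b \<le> r powr b" using \<open>0 < b\<close> by (intro powr_mono2) (auto simp: diameter_ge_0)
    qed
    also have "\<dots> = real n * r powr b" using us(2) by (simp add: sum_list_triv)
    also have "\<dots> \<le> r powr (- a) * r powr b" using \<open>real n < r powr (- a)\<close> by (intro mult_right_mono) auto
    also have "\<dots> = r powr (b - a)" by (simp flip: powr_add)
    also have "\<dots> \<le> (e powr (1 / (b - a))) powr (b - a)" using r a(2) by (intro powr_mono2) auto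
    also have "\<dots> = e" using a(2) \<open>0 < e\<close> by (simp add: powr_powr)
    finally show "\<exists>us. F \<subseteq> \<Union>(set us) \<and> (\<forall>U\<in>set us. bounded U \<and> diameter U \<le> \<delta>) \<and>
      (\<Sum>U\<leftarrow>us. diameter U powr b) \<le> e" using us(1) U r(3) by (intro exI[of _ us]) force
  qed
  then have "hausdorff_dim F \<le> ereal b" using \<open>0 < b\<close> by (intro hausdorff_dim_le) simp
  then show "hausdorff_dim F \<le> z" using b(2) by simp
qed

lemma open_enlargement:
  fixes U :: "'a::metric_space set"
  assumes "bounded U" "0 < t" "0 < e"
  obtains V where "open V" "U \<subseteq> V" "bounded V" "diameter V powr t \<le> diameter U powr t + e"
proof -
  have "((\<lambda>h. (diameter U + 2 * h) powr t) \<longlongrightarrow> (diameter U + 2 * 0) powr t) (at_right 0)"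
    using diameter_ge_0[OF assms(1)] assms(2)
    by (intro tendsto_powr' tendsto_intros) (auto intro!: eventually_at_rightI[of 0 1])
  then have "\<forall>\<^sub>F h in at_right 0. dist ((diameter U + 2 * h) powr t) (diameter U powr t) < e"
    using assms(3) by (simp add: tendsto_iff)
  moreover have "\<forall>\<^sub>F h in at_right 0. h \<in> {0<..<1::real}" by (rule eventually_at_right_real) simp
  ultimately have "\<forall>\<^sub>F h in at_right 0. dist ((diameter U + 2 * h) powr t) (diameter U powr t) < e \<and> h \<in> {0<..<1}"
    by (rule eventually_conj)
  then have "\<exists>h. dist ((diameter U + 2 * h) powr t) (diameter U powr t) < e \<and> h \<in> {0<..<1}"
    by (rule eventually_happens'[rotated]) simp
  then obtain h where h: "0 < h" "(diameter U + 2 * h) powr t \<le> diameter U powr t + e"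
    by (auto simp: dist_real_def)
  let ?V = "\<Union>u\<in>U. ball u h"
  have d: "dist x y \<le> diameter U + 2 * h" if "x \<in> ?V" "y \<in> ?V" for x y
  proof -
    from that obtain u v where uv: "u \<in> U" "v \<in> U" "dist u x < h" "dist v y < h" by auto
    have "dist u v \<le> diameter U" using uv assms(1) by (intro diameter_bounded_bound) auto
    then show ?thesis
      using uv dist_triangle[of x y u] dist_triangle[of u y v] by (simp add: dist_commute)
  qed
  have "bounded ?V" unfolding bounded_two_points using d by blast
  moreover have "diameter ?V \<le> diameter U + 2 * h"
    using d h(1) diameter_ge_0[OF assms(1)] by (intro diameter_le_dist) auto
  then have "diameter ?V powr t \<le> (diameter U + 2 * h) powr t"
    using diameter_ge_0[OF \<open>bounded ?V\<close>] assms(2) by (intro powr_mono2) auto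
  ultimately show thesis
    using h by (intro that[of ?V]) auto
qed

text \<open>
  The sets of a countable cover with small sum are enlarged to open sets at a total cost of \<^term>\<open>\<eta> / 2\<close>,
  distributed geometrically; compactness then makes the cover finite.
\<close>
lemma hausdorff_null_finite_cover:
  fixes F :: "'a::metric_space set"
  assumes "compact F" "0 < t" "hausdorff_measure t F = 0" "0 < \<eta>"
  obtains J and V :: "nat \<Rightarrow> 'a set" where "finite J" "F \<subseteq> (\<Union>j\<in>J. V j)" "\<And>j. bounded (V j)"
    "(\<Sum>j\<in>J. diameter (V j) powr t) < \<eta>"
proof -
  have "hausdorff_premeasure t 1 F \<le> hausdorff_measure t F"
    unfolding hausdorff_measure_def by (rule SUP_upper) simp
  then have "hausdorff_premeasure t 1 F < ennreal (\<eta> / 2)" using assms(3,4) by simp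
  then obtain U :: "nat \<Rightarrow> 'a set" where U: "\<forall>i. bounded (U i) \<and> diameter (U i) \<le> 1" "F \<subseteq> (\<Union>i. U i)"
    and sumU: "(\<Sum>i. ennreal (diam_powr t (U i))) < ennreal (\<eta> / 2)"
    unfolding hausdorff_premeasure_def INF_less_iff by auto
  have "\<exists>V. open V \<and> U i \<subseteq> V \<and> bounded V \<and> diameter V powr t \<le> diameter (U i) powr t + \<eta> / 2 * (1 / 2) ^ Suc i" for i
  proof -
    have "bounded (U i)" "0 < \<eta> / 2 * (1 / 2) ^ Suc i" using U(1) assms(4) by auto
    then show ?thesis using open_enlargement[of "U i" t] assms(2) by metis
  qed
  then obtain V where V: "\<And>i. open (V i)" "\<And>i. U i \<subseteq> V i" "\<And>i. bounded (V i)"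
    "\<And>i. diameter (V i) powr t \<le> diameter (U i) powr t + \<eta> / 2 * (1 / 2) ^ Suc i" by metis
  have "F \<subseteq> (\<Union>i. V i)" using U(2) V(2) by blast
  then obtain J where J: "finite J" "F \<subseteq> (\<Union>j\<in>J. V j)"
    by (rule compactE_image[OF assms(1) V(1)])
  have "ennreal (\<Sum>j\<in>J. diameter (U j) powr t) = (\<Sum>j\<in>J. ennreal (diam_powr t (U j)))"
    using assms(2) by (simp add: diam_powr_eq)
  also have "\<dots> \<le> (\<Sum>i. ennreal (diam_powr t (U i)))" using J(1) by (intro sum_le_suminf) auto
  also have "\<dots> < ennreal (\<eta> / 2)" by (rule sumU)
  finally have small: "(\<Sum>j\<in>J. diameter (U j) powr t) < \<eta> / 2"
    by (metis ennreal_less_iff powr_ge_zero sum_nonneg)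
  have "(\<Sum>j\<in>J. (1 / 2) ^ Suc j) \<le> (\<Sum>j. (1 / 2) ^ Suc j :: real)"
    using J(1) power_half_series by (intro sum_le_suminf) (auto simp: sums_iff)
  also have "\<dots> = 1" using power_half_series by (simp add: sums_iff)
  finally have geom: "(\<Sum>j\<in>J. (1 / 2) ^ Suc j :: real) \<le> 1" .
  have "(\<Sum>j\<in>J. diameter (V j) powr t) \<le> (\<Sum>j\<in>J. diameter (U j) powr t + \<eta> / 2 * (1 / 2) ^ Suc j)"
    by (intro sum_mono V(4))
  also have "\<dots> = (\<Sum>j\<in>J. diameter (U j) powr t) + \<eta> / 2 * (\<Sum>j\<in>J. (1 / 2) ^ Suc j)"
    by (simp only: sum.distrib sum_distrib_left)
  also have "\<dots> < \<eta> / 2 + \<eta> / 2 * 1"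
    using small geom assms(4) by (intro add_less_le_mono mult_left_mono) auto
  finally show thesis using that[of J V] J V(3) by simp
qed

text \<open>
  In dimension 0 every non-empty member of a cover contributes 1.
\<close>
lemma hausdorff_measure_0_nonzero:
  fixes F :: "'a::metric_space set"
  assumes "F \<noteq> {}"
  shows "hausdorff_measure 0 F \<noteq> 0"
proof -
  have "1 \<le> hausdorff_premeasure 0 1 F"
    unfolding hausdorff_premeasure_def
  proof (rule INF_greatest)
    fix U :: "nat \<Rightarrow> 'a set"
    assume "U \<in> {U. (\<forall>i. bounded (U i) \<and> diameter (U i) \<le> 1) \<and> F \<subseteq> (\<Union>i. U i)}"
    then obtain i where "U i \<noteq> {}" using assms by blast
    then have "1 = ennreal (diam_powr 0 (U i))" by (simp add: diam_powr_def)
    also have "\<dots> \<le> (\<Sum>i. ennreal (diam_powr 0 (U i)))"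
      using sum_le_suminf[of "\<lambda>i. ennreal (diam_powr 0 (U i))" "{i}"] by simp
    finally show "1 \<le> (\<Sum>i. ennreal (diam_powr 0 (U i)))" .
  qed
  also have "\<dots> \<le> hausdorff_measure 0 F" unfolding hausdorff_measure_def by (rule SUP_upper) simp
  finally show ?thesis by auto
qed

section \<open>Sets that contain copies of themselves in every ball\<close>

text \<open>
  Falconer's hypothesis for his implicit theorem on the equality of dimensions. The copy in a ball of radius
  \<^term>\<open>R\<close> may be distorted, but distances shrink at most by the factor \<^term>\<open>c * R\<close>. Copies in
  different balls may intersect, so that self-similar sets with overlaps are covered.
\<close>
definition has_copies_in_balls :: "real \<Rightarrow> 'a::metric_space set \<Rightarrow> bool" where
  "has_copies_in_balls c F \<longleftrightarrow> (\<forall>x\<in>F. \<forall>R\<in>{0<..1}. \<exists>g. g ` F \<subseteq> F \<inter> cball x R \<and>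
     (\<forall>y\<in>F. \<forall>z\<in>F. c * R * dist y z \<le> dist (g y) (g z)))"

lemma has_copies_in_ballsE:
  assumes "has_copies_in_balls c F" "x \<in> F" "0 < R" "R \<le> 1"
  obtains g where "g ` F \<subseteq> F \<inter> cball x R"
    "\<And>y z. y \<in> F \<Longrightarrow> z \<in> F \<Longrightarrow> c * R * dist y z \<le> dist (g y) (g z)"
proof -
  have "R \<in> {0<..1}" using assms(3,4) by simp
  then show thesis using assms(1,2) that unfolding has_copies_in_balls_def by metis
qed

text \<open>
  The covering numbers of a small ball are at least those of the whole set at the rescaled size: a
  separated net of the whole set is carried into the ball by the copying map. The factor 4 is lost
  between separated nets and covers.
\<close>
lemma covering_number_ball_ge:
  assumes "has_copies_in_balls c F" "compact F" "0 < c" "x \<in> F" "0 < R" "R \<le> 1" "0 < r"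
  shows "covering_number (4 * r / (c * R)) F \<le> covering_number r (cball x R \<inter> F)"
proof -
  let ?d = "r / (c * R)"
  have d: "0 < ?d" using assms by simp
  obtain P where P: "finite P" "P \<subseteq> F" "\<And>p q. p \<in> P \<Longrightarrow> q \<in> P \<Longrightarrow> p \<noteq> q \<Longrightarrow> ?d < dist p q"
    "F \<subseteq> (\<Union>p\<in>P. cball p ?d)"
    using separated_net_exists[OF assms(2) d] by metis
  obtain g where g: "g ` F \<subseteq> F \<inter> cball x R"
    "\<And>y z. y \<in> F \<Longrightarrow> z \<in> F \<Longrightarrow> c * R * dist y z \<le> dist (g y) (g z)"
    using has_copies_in_ballsE[OF assms(1,4,5,6)] by metis
  have sep: "r < dist (g p) (g q)" if "p \<in> P" "q \<in> P" "p \<noteq> q" for p q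
  proof -
    have "r < c * R * dist p q" using P(3)[OF that] assms(3,5) by (simp add: field_simps)
    also have "\<dots> \<le> dist (g p) (g q)" using g(2) that P(2) by blast
    finally show ?thesis .
  qed
  have "inj_on g P"
  proof (rule inj_onI, rule ccontr)
    fix p q assume "p \<in> P" "q \<in> P" "g p = g q" "p \<noteq> q"
    then show False using sep[of p q] assms(7) by simp
  qed
  have "covering_number (4 * r / (c * R)) F \<le> enat (card P)"
    using covering_number_le_card_net[OF P(1,4) d] by simp
  also have "\<dots> = enat (card (g ` P))" using \<open>inj_on g P\<close> by (simp add: card_image)
  also have "\<dots> \<le> covering_number r (cball x R \<inter> F)"
  proof (rule card_separated_le_covering_number)
    show "g ` P \<subseteq> cball x R \<inter> F" using g(1) P(2) by blast
    fix p q assume "p \<in> g ` P" "q \<in> g ` P" "p \<noteq> q"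
    then show "r < dist p q" using sep by blast
  qed (use P(1) in simp)
  finally show ?thesis .
qed

lemma covering_number_ge_of_box_ratio:
  assumes "ereal a < box_ratio E r" "0 < r" "r < 1" "E \<noteq> {}"
  shows "ereal ((1 / r) powr a) \<le> ereal_of_enat (covering_number r E)"
proof (cases "covering_number r E")
  case (enat n)
  have "0 < n" using covering_number_ge_1[OF assms(4), of r] enat by (simp add: one_enat_def)
  have "a < ln (real n) / (- ln r)" using assms(1) by (simp add: box_ratio_def enat)
  moreover have "0 < - ln r" using assms by simp
  ultimately have "a * (- ln r) < ln (real n)" by (simp only: pos_less_divide_eq)
  then have "ln ((1 / r) powr a) < ln (real n)" using assms(2) by (simp add: ln_div)
  then have "(1 / r) powr a < real n" using assms(2) \<open>0 < n\<close> by (subst (asm) ln_less_cancel_iff) auto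
  then show ?thesis by (simp add: enat)
qed simp

text \<open>
  By \<open>covering_number_ball_ge\<close> the growth of the covering numbers of the whole set, which exceeds exponent
  \<^term>\<open>a\<close> for every \<^term>\<open>a\<close> below the lower box dimension, is inherited by all balls uniformly. Only the scales
  \<^term>\<open>r\<close> comparable to \<^term>\<open>R\<close> need a separate, trivial bound.
\<close>
lemma lower_box_dim_le_lower_dim:
  fixes F :: "'a::metric_space set"
  assumes copies: "has_copies_in_balls c F" and "0 < c" "compact F" "F \<noteq> {}"
  shows "lower_box_dim F \<le> lower_dim F"
proof (rule dense_le)
  fix z assume "z < lower_box_dim F"
  then obtain a where a: "z < ereal a" "ereal a < lower_box_dim F" using ereal_dense2 by blast
  have "\<forall>\<^sub>F r in at_right 0. ereal a < box_ratio F r"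
    using a(2) unfolding lower_box_dim_def by (rule less_LiminfD)
  then obtain b where "0 < b" and b: "\<And>r. 0 < r \<Longrightarrow> r < b \<Longrightarrow> ereal a < box_ratio F r"
    by (auto simp: eventually_at_right_field)
  define \<delta> where "\<delta> = min b 1"
  have \<delta>: "0 < \<delta>" "\<delta> \<le> 1" "\<delta> \<le> b" using \<open>0 < b\<close> by (auto simp: \<delta>_def)
  have ge1: "1 \<le> ereal_of_enat (covering_number r (cball x R \<inter> F))" if "x \<in> F" "0 < R" for x r R
  proof -
    have "x \<in> cball x R \<inter> F" using that by simp
    then have "cball x R \<inter> F \<noteq> {}" by blast
    from covering_number_ge_1[OF this, of r] show ?thesis
      by (cases "covering_number r (cball x R \<inter> F)") (auto simp: one_enat_def)
  qed
  have "\<exists>C>0. \<forall>r R x. 0 < r \<and> r < R \<and> R \<le> 1 \<and> x \<in> F \<longrightarrow>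
      ereal (C * (R / r) powr a) \<le> ereal_of_enat (covering_number r (cball x R \<inter> F))"
  proof (cases "0 \<le> a")
    case True
    show ?thesis
    proof (intro exI[of _ "(c * \<delta> / 4) powr a"] conjI allI impI)
      show "0 < (c * \<delta> / 4) powr a" using \<open>0 < c\<close> \<delta> by simp
      fix r R :: real and x assume H: "0 < r \<and> r < R \<and> R \<le> 1 \<and> x \<in> F"
      have eq: "(c * \<delta> / 4) powr a * (R / r) powr a = (\<delta> * (c * R / (4 * r))) powr a"
        using H \<open>0 < c\<close> \<delta> by (simp flip: powr_mult add: field_simps)
      show "ereal ((c * \<delta> / 4) powr a * (R / r) powr a) \<le> ereal_of_enat (covering_number r (cball x R \<inter> F))"
      proof (cases "4 * r / (c * R) < \<delta>")
        case small: True
        have "(\<delta> * (c * R / (4 * r))) powr a \<le> (1 / (4 * r / (c * R))) powr a"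
          using H \<open>0 < c\<close> \<delta> True by (intro powr_mono2) (auto simp: divide_right_mono mult_le_cancel_right1)
        then have "ereal ((c * \<delta> / 4) powr a * (R / r) powr a) \<le> ereal ((1 / (4 * r / (c * R))) powr a)"
          unfolding eq by simp
        also have "\<dots> \<le> ereal_of_enat (covering_number (4 * r / (c * R)) F)"
        proof (rule covering_number_ge_of_box_ratio)
          show "0 < 4 * r / (c * R)" using H \<open>0 < c\<close> by simp
          then show "ereal a < box_ratio F (4 * r / (c * R))" using b small \<delta> by simp
          show "4 * r / (c * R) < 1" using small \<delta> by linarith
        qed (rule assms(4))
        also have "\<dots> \<le> ereal_of_enat (covering_number r (cball x R \<inter> F))"
          using covering_number_ball_ge[OF copies assms(3,2)] H by simp
        finally show ?thesis .
      next
        case False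
        then have "\<delta> * (c * R / (4 * r)) \<le> 1" using H \<open>0 < c\<close> by (simp add: field_simps not_less)
        then have "(\<delta> * (c * R / (4 * r))) powr a \<le> 1 powr a"
          using H \<open>0 < c\<close> \<delta> True by (intro powr_mono2) auto
        then show ?thesis using ge1[of x R r] H unfolding eq
          by (metis ereal_less_eq(3) one_ereal_def order_trans powr_one_eq_one order_less_trans)
      qed
    qed
  next
    case False
    show ?thesis
    proof (intro exI[of _ 1] conjI allI impI)
      fix r R :: real and x assume H: "0 < r \<and> r < R \<and> R \<le> 1 \<and> x \<in> F"
      then have "(R / r) powr a \<le> (R / r) powr 0" using False by (intro powr_mono) auto
      then have "ereal (1 * (R / r) powr a) \<le> 1" using H by simp
      also have "\<dots> \<le> ereal_of_enat (covering_number r (cball x R \<inter> F))" using H ge1 by simp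
      finally show "ereal (1 * (R / r) powr a) \<le> ereal_of_enat (covering_number r (cball x R \<inter> F))" .
    qed simp
  qed
  then obtain C where C: "0 < C" "\<And>r R x. 0 < r \<Longrightarrow> r < R \<Longrightarrow> R \<le> 1 \<Longrightarrow> x \<in> F \<Longrightarrow>
      ereal (C * (R / r) powr a) \<le> ereal_of_enat (covering_number r (cball x R \<inter> F))" by blast
  have "ereal a \<le> lower_dim F"
    unfolding lower_dim_def
  proof (rule SUP_upper, intro CollectI exI conjI allI impI)
    show "0 < C" by (rule C(1))
    show "(0::real) < 1" by simp
    fix r R :: real assume "0 < r \<and> r < R \<and> R \<le> 1"
    then show "ereal (C * (R / r) powr a) \<le> (INF x\<in>F. ereal_of_enat (covering_number r (cball x R \<inter> F)))"
      using C(2) by (intro INF_greatest) auto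
  qed
  then show "z \<le> lower_dim F" using a(1) by simp
qed

text \<open>
  A replacement for the mass distribution principle that needs no measure. If a set contains \<^term>\<open>card I\<close>
  copies of itself at mutual distance at least \<^term>\<open>d\<close>, then a cover by sets of diameter less than \<^term>\<open>d\<close> splits into
  disjoint covers of the copies. Pulled back along the copying maps, each of these becomes a cover of the whole
  set with strictly fewer members, whose \<^term>\<open>t\<close>-dimensional sum grows at most by the factor
  \<^term>\<open>c powr (- t)\<close>. By induction each piece has sum at least \<^term>\<open>c powr t * d powr t\<close>, and the hypothesis
  on \<^term>\<open>card I\<close> says precisely that these add up to at least \<^term>\<open>d powr t\<close>.
\<close>
lemma separated_copies_sum_ge:
  fixes F :: "'a::metric_space set" and U :: "'j \<Rightarrow> 'a set"
  assumes I: "finite I" "2 \<le> card I" "1 \<le> real (card I) * c powr t"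
    and F: "F \<noteq> {}" "\<And>i. i \<in> I \<Longrightarrow> g i ` F \<subseteq> F"
    and expand: "\<And>i y z. i \<in> I \<Longrightarrow> y \<in> F \<Longrightarrow> z \<in> F \<Longrightarrow> c * dist y z \<le> dist (g i y) (g i z)"
    and sep: "\<And>i j y z. i \<in> I \<Longrightarrow> j \<in> I \<Longrightarrow> i \<noteq> j \<Longrightarrow> y \<in> F \<Longrightarrow> z \<in> F \<Longrightarrow> d \<le> dist (g i y) (g j z)"
    and pos: "0 < c" "0 < d" "0 < t"
  shows "finite J \<Longrightarrow> F \<subseteq> (\<Union>j\<in>J. U j) \<Longrightarrow> (\<And>j. j \<in> J \<Longrightarrow> bounded (U j)) \<Longrightarrow>
    d powr t \<le> (\<Sum>j\<in>J. diameter (U j) powr t)"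
proof (induction J arbitrary: U rule: finite_psubset_induct)
  case (psubset J)
  show ?case
  proof (cases "\<exists>j\<in>J. d \<le> diameter (U j)")
    case True
    then obtain j where j: "j \<in> J" "d \<le> diameter (U j)" by blast
    have "d powr t \<le> diameter (U j) powr t" using j(2) pos by (intro powr_mono2) auto
    also have "\<dots> \<le> (\<Sum>j\<in>J. diameter (U j) powr t)"
      using psubset.hyps j(1) by (intro member_le_sum) auto
    finally show ?thesis .
  next
    case False
    define K where "K i = {j \<in> J. \<exists>y\<in>F. g i y \<in> U j}" for i
    have "K i \<subseteq> J" for i by (auto simp: K_def)
    then have finK: "finite (K i)" for i using psubset.hyps by (rule finite_subset)
    have disj: "K i \<inter> K i' = {}" if i: "i \<in> I" "i' \<in> I" "i \<noteq> i'" for i i'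
    proof (rule ccontr)
      assume "K i \<inter> K i' \<noteq> {}"
      then obtain j y z where j: "j \<in> J" "y \<in> F" "z \<in> F" "g i y \<in> U j" "g i' z \<in> U j"
        by (auto simp: K_def)
      have "d \<le> dist (g i y) (g i' z)" using sep i j by blast
      also have "\<dots> \<le> diameter (U j)" using psubset.prems(2) j by (intro diameter_bounded_bound)
      finally show False using False j(1) by blast
    qed
    have nonempty: "K i \<noteq> {}" if "i \<in> I" for i
    proof -
      obtain y where "y \<in> F" using F(1) by blast
      then have "g i y \<in> F" using F(2) that by blast
      then obtain j where "j \<in> J" "g i y \<in> U j" using psubset.prems(1) by blast
      then show ?thesis using \<open>y \<in> F\<close> by (auto simp: K_def)
    qed
    have piece: "c powr t * d powr t \<le> (\<Sum>j\<in>K i. diameter (U j) powr t)" if i: "i \<in> I" for i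
    proof -
      have "I \<noteq> {i}" using I(2) by auto
      then obtain i' where "i' \<in> I" "i' \<noteq> i" using i by blast
      then have "K i \<subset> J" using disj[of i i'] nonempty[of i'] i \<open>\<And>i. K i \<subseteq> J\<close> by blast
      define V where "V j = {y \<in> F. g i y \<in> U j}" for j
      have dV: "c * dist y z \<le> diameter (U j)" if "j \<in> K i" "y \<in> V j" "z \<in> V j" for j y z
      proof -
        have "c * dist y z \<le> dist (g i y) (g i z)" using expand i that by (auto simp: V_def)
        also have "\<dots> \<le> diameter (U j)"
          using psubset.prems(2) that by (intro diameter_bounded_bound) (auto simp: V_def K_def)
        finally show ?thesis .
      qed
      have bV: "bounded (V j)" if "j \<in> K i" for j
        using dV[OF that] pos(1) by (auto simp: bounded_two_points pos_le_divide_eq mult.commute intro!: exI[of _ "diameter (U j) / c"])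
      have diamV: "c * diameter (V j) \<le> diameter (U j)" if "j \<in> K i" for j
      proof -
        have "bounded (U j)" using psubset.prems(2) that by (simp add: K_def)
        then have "diameter (V j) \<le> diameter (U j) / c"
          using dV[OF that] pos(1) diameter_ge_0[of "U j"]
          by (intro diameter_le_dist) (auto simp: pos_le_divide_eq mult.commute)
        then show ?thesis using pos(1) by (simp add: pos_le_divide_eq mult.commute)
      qed
      have "F \<subseteq> (\<Union>j\<in>K i. V j)"
      proof
        fix y assume "y \<in> F"
        then have "g i y \<in> F" using F(2) i by blast
        then obtain j where "j \<in> J" "g i y \<in> U j" using psubset.prems(1) by blast
        then show "y \<in> (\<Union>j\<in>K i. V j)" using \<open>y \<in> F\<close> by (auto simp: K_def V_def)
      qed
      then have "d powr t \<le> (\<Sum>j\<in>K i. diameter (V j) powr t)"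
        using psubset.IH[OF \<open>K i \<subset> J\<close>, of V] bV by blast
      then have "c powr t * d powr t \<le> (\<Sum>j\<in>K i. c powr t * diameter (V j) powr t)"
        by (simp add: mult_left_mono flip: sum_distrib_left)
      also have "\<dots> \<le> (\<Sum>j\<in>K i. diameter (U j) powr t)"
      proof (rule sum_mono)
        fix j assume j: "j \<in> K i"
        have "0 \<le> diameter (V j)" using bV[OF j] by (rule diameter_ge_0)
        then have "c powr t * diameter (V j) powr t = (c * diameter (V j)) powr t"
          using pos(1) by (simp add: powr_mult)
        also have "\<dots> \<le> diameter (U j) powr t"
          using diamV[OF j] pos \<open>0 \<le> diameter (V j)\<close> by (intro powr_mono2) auto
        finally show "c powr t * diameter (V j) powr t \<le> diameter (U j) powr t" .
      qed
      finally show ?thesis .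
    qed
    have "d powr t \<le> real (card I) * c powr t * d powr t"
      using I(3) by (simp add: mult_le_cancel_right1)
    also have "\<dots> = (\<Sum>i\<in>I. c powr t * d powr t)" by simp
    also have "\<dots> \<le> (\<Sum>i\<in>I. \<Sum>j\<in>K i. diameter (U j) powr t)" by (intro sum_mono piece)
    also have "\<dots> = (\<Sum>j\<in>(\<Union>i\<in>I. K i). diameter (U j) powr t)"
      using I(1) finK disj by (intro sum.UNION_disjoint[symmetric]) auto
    also have "\<dots> \<le> (\<Sum>j\<in>J. diameter (U j) powr t)"
      using psubset.hyps \<open>\<And>i. K i \<subseteq> J\<close> by (intro sum_mono2) auto
    finally show ?thesis .
  qed
qed

text \<open>
  Around \<^term>\<open>3 * e\<close>-separated points the balls of radius \<^term>\<open>e\<close> are at distance at least \<^term>\<open>e\<close>, so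
  the copies they contain are separated. Too many of them would bound all finite covers from below by
  \<open>separated_copies_sum_ge\<close>, contradicting the vanishing of the Hausdorff measure.
\<close>
lemma card_net_less_of_hausdorff_null:
  fixes F :: "'a::metric_space set"
  assumes copies: "has_copies_in_balls c F" and "0 < c" "compact F" "F \<noteq> {}"
    and t: "0 < t" "hausdorff_measure t F = 0"
    and P: "finite P" "P \<subseteq> F" "\<And>p q. p \<in> P \<Longrightarrow> q \<in> P \<Longrightarrow> p \<noteq> q \<Longrightarrow> 3 * e < dist p q"
    and e: "0 < e" "e \<le> 1" and "2 \<le> card P"
  shows "real (card P) * (c * e) powr t < 1"
proof (rule ccontr)
  assume "\<not> real (card P) * (c * e) powr t < 1"
  then have big: "1 \<le> real (card P) * (c * e) powr t" by simp
  have "\<forall>p\<in>P. \<exists>g. g ` F \<subseteq> F \<inter> cball p e \<and> (\<forall>y\<in>F. \<forall>z\<in>F. c * e * dist y z \<le> dist (g y) (g z))"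
    using copies P(2) e unfolding has_copies_in_balls_def by auto
  then obtain g where g: "\<And>p. p \<in> P \<Longrightarrow> g p ` F \<subseteq> F \<inter> cball p e"
    "\<And>p y z. p \<in> P \<Longrightarrow> y \<in> F \<Longrightarrow> z \<in> F \<Longrightarrow> c * e * dist y z \<le> dist (g p y) (g p z)" by metis
  have sep: "e \<le> dist (g p y) (g q z)" if "p \<in> P" "q \<in> P" "p \<noteq> q" "y \<in> F" "z \<in> F" for p q y z
  proof -
    have "dist p (g p y) \<le> e" "dist q (g q z) \<le> e" using g(1) that by (auto simp: image_subset_iff)
    then show ?thesis using P(3)[OF that(1-3)]
        dist_triangle[of p q "g p y"] dist_triangle[of "g p y" q "g q z"] by (simp add: dist_commute)
  qed
  have "0 < e powr t" using e by simp
  then obtain J and V :: "nat \<Rightarrow> 'a set" where J: "finite J" "F \<subseteq> (\<Union>j\<in>J. V j)" "\<And>j. bounded (V j)"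
    "(\<Sum>j\<in>J. diameter (V j) powr t) < e powr t"
    using hausdorff_null_finite_cover[OF assms(3) t] by metis
  have "e powr t \<le> (\<Sum>j\<in>J. diameter (V j) powr t)"
  proof (rule separated_copies_sum_ge[where g = g and I = P and c = "c * e" and F = F])
    show "\<And>p. p \<in> P \<Longrightarrow> g p ` F \<subseteq> F" using g(1) by blast
  qed (use assms big g(2) sep J in auto)
  then show False using J(4) by simp
qed

lemma upper_box_dim_le_hausdorff_dim:
  fixes F :: "'a::metric_space set"
  assumes copies: "has_copies_in_balls c F" and "0 < c" "compact F" "F \<noteq> {}"
  shows "upper_box_dim F \<le> hausdorff_dim F"
  unfolding hausdorff_dim_def
proof (rule INF_greatest, clarify)
  fix t :: real assume "0 \<le> t" and null: "hausdorff_measure t F = 0"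
  then have t: "0 < t" using hausdorff_measure_0_nonzero[OF assms(4)] by (cases "t = 0") auto
  \<comment> \<open>A cover at scale \<^term>\<open>r\<close> comes from a net at distance \<^term>\<open>r / 4 = 3 * e\<close>, whence \<^term>\<open>12 = 4 * (3::nat)\<close>; the 1 is for nets with a single point.\<close>
  let ?C = "max 1 ((12 / c) powr t)"
  show "upper_box_dim F \<le> ereal t"
  proof (rule upper_box_dim_le[OF assms(4)])
    show "0 < ?C" by simp
    have "\<forall>\<^sub>F r in at_right 0. r \<in> {0<..<1::real}" by (rule eventually_at_right_real) simp
    then show "\<forall>\<^sub>F r in at_right 0. ereal_of_enat (covering_number r F) \<le> ereal (?C * (1 / r) powr t)"
    proof eventually_elim
      case (elim r)
      define e where "e = r / 12"
      have e: "0 < e" "e \<le> 1" "0 < 3 * e" using elim by (auto simp: e_def)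
      obtain P where P: "finite P" "P \<subseteq> F" "\<And>p q. p \<in> P \<Longrightarrow> q \<in> P \<Longrightarrow> p \<noteq> q \<Longrightarrow> 3 * e < dist p q"
        "F \<subseteq> (\<Union>p\<in>P. cball p (3 * e))"
        using separated_net_exists[OF assms(3) e(3)] by metis
      have one: "1 \<le> (1 / r) powr t" using elim t by (intro ge_one_powr_ge_zero) auto
      have "real (card P) \<le> ?C * (1 / r) powr t"
      proof (cases "2 \<le> card P")
        case True
        have pos: "0 < (c * e) powr t" using e \<open>0 < c\<close> by simp
        have "real (card P) * (c * e) powr t < 1"
          using card_net_less_of_hausdorff_null[OF copies assms(2-4) t null P(1-3) e(1,2) True] by simp
        then have "real (card P) < 1 / (c * e) powr t" using pos by (simp add: field_simps)
        also have "\<dots> = (1 / (c * e)) powr t" by (simp add: powr_divide)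
        also have "1 / (c * e) = 12 / c * (1 / r)" by (simp add: e_def)
        also have "(12 / c * (1 / r)) powr t = (12 / c) powr t * (1 / r) powr t" by (rule powr_mult)
        also have "\<dots> \<le> ?C * (1 / r) powr t" by (intro mult_right_mono) auto
        finally show ?thesis by simp
      next
        case False
        then have "real (card P) \<le> 1 * 1" by simp
        also have "\<dots> \<le> ?C * (1 / r) powr t" using one by (intro mult_mono) auto
        finally show ?thesis .
      qed
      moreover have "covering_number r F \<le> enat (card P)"
        using covering_number_le_card_net[OF P(1,4) e(3)] by (simp add: e_def)
      then have "ereal_of_enat (covering_number r F) \<le> ereal_of_enat (enat (card P))"
        by (simp only: ereal_of_enat_le_iff)
      ultimately show ?case by (simp add: order_trans)
    qed
  qed
qed

text \<open>
  The dimensions are squeezed by two cycles of inequalities, one between lower and lower box dimension and one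
  from Hausdorff dimension through lower and upper box dimension back to Hausdorff dimension.
\<close>
theorem dims_eq_of_copies_in_balls:
  fixes F :: "'a::metric_space set"
  assumes "has_copies_in_balls c F" "0 < c" "compact F" "F \<noteq> {}"
  shows "lower_dim F = hausdorff_dim F" "lower_box_dim F = hausdorff_dim F" "upper_box_dim F = hausdorff_dim F"
  using lower_box_dim_le_lower_dim[OF assms] lower_dim_le_lower_box_dim[OF assms(4)]
    hausdorff_dim_le_lower_box_dim[OF assms(4)] lower_box_dim_le_upper_box_dim[of F]
    upper_box_dim_le_hausdorff_dim[OF assms] by (auto intro: order_antisym order_trans)

section \<open>The attractor\<close>

lemma ifs_cases:
  assumes "S \<in> ifs \<alpha> \<beta> \<gamma>"
  obtains \<rho> b where "\<rho> \<in> {\<alpha>, \<beta>, \<gamma>}" "S = (\<lambda>x. \<rho> * x + b)"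
proof -
  from assms consider "S = (\<lambda>x. \<alpha> * x + 0)" | "S = (\<lambda>x. \<beta> * x + 0)" | "S = (\<lambda>x. \<gamma> * x + (1 - \<gamma>))"
    by (auto simp: ifs_def)
  then show thesis using that by cases blast+
qed

lemma attractor_ex_preimage:
  assumes "is_attractor X \<S> F" "x \<in> F"
  obtains S y where "S \<in> \<S>" "y \<in> F" "x = S y"
  using assms unfolding is_attractor_def by blast

lemma attractor_image_mem:
  assumes "is_attractor X \<S> F" "S \<in> \<S>" "y \<in> F"
  shows "S y \<in> F"
  using assms unfolding is_attractor_def by blast

text \<open>
  Writing a point of one attractor as the image of another of its points, and approximating the latter by a
  point of the other attractor, improves the approximation by the largest contraction ratio. By symmetry this
  yields uniqueness of the attractor.
\<close>
lemma attractor_subset_attractor: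
  fixes F G :: "real set"
  assumes F: "is_attractor {0..1} (ifs \<alpha> \<beta> \<gamma>) F" and G: "is_attractor {0..1} (ifs \<alpha> \<beta> \<gamma>) G"
    and range: "0 < \<alpha>" "\<alpha> < 1" "0 < \<beta>" "\<beta> < 1" "0 < \<gamma>" "\<gamma> < 1"
  shows "F \<subseteq> G"
proof
  define M where "M = Max {\<alpha>, \<beta>, \<gamma>}"
  have M: "0 < M" "M < 1" "\<And>\<rho>. \<rho> \<in> {\<alpha>, \<beta>, \<gamma>} \<Longrightarrow> \<rho> \<le> M" using range by (auto simp: M_def less_max_iff_disj)
  have approx: "\<forall>x\<in>F. \<exists>y\<in>G. dist y x \<le> M ^ n" for n
  proof (induction n)
    case 0
    obtain y where y: "y \<in> G" using G unfolding is_attractor_def by blast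
    have "dist y x \<le> 1" if "x \<in> F" for x
    proof -
      have "x \<in> {0..1}" "y \<in> {0..1}" using that y F G unfolding is_attractor_def by blast+
      then show ?thesis by (auto simp: dist_real_def)
    qed
    then show ?case using y by auto
  next
    case (Suc n)
    show ?case
    proof
      fix x assume "x \<in> F"
      with F obtain S x' where S: "S \<in> ifs \<alpha> \<beta> \<gamma>" "x' \<in> F" "x = S x'" by (rule attractor_ex_preimage)
      from S(1) obtain \<rho> b where \<rho>: "\<rho> \<in> {\<alpha>, \<beta>, \<gamma>}" "S = (\<lambda>x. \<rho> * x + b)" by (rule ifs_cases)
      obtain y where y: "y \<in> G" "dist y x' \<le> M ^ n" using Suc.IH S(2) by blast
      have "0 \<le> \<rho>" using \<rho>(1) range by auto
      have "dist (S y) x = \<rho> * dist y x'"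
        using \<rho>(2) S(3) \<open>0 \<le> \<rho>\<close> by (simp add: dist_real_def abs_mult flip: right_diff_distrib)
      also have "\<dots> \<le> M * M ^ n" using M \<rho>(1) y(2) by (intro mult_mono) auto
      finally show "\<exists>y\<in>G. dist y x \<le> M ^ Suc n"
        using attractor_image_mem[OF G S(1) y(1)] by auto
    qed
  qed
  fix x assume x: "x \<in> F"
  have "closed G" using G by (simp add: is_attractor_def compact_imp_closed)
  moreover have "\<exists>y\<in>G. dist y x < e" if "0 < e" for e
  proof -
    obtain n where "M ^ n < e" using real_arch_pow_inv[OF \<open>0 < e\<close> M(2)] by blast
    moreover obtain y where "y \<in> G" "dist y x \<le> M ^ n" using approx[of n] x by blast
    ultimately show ?thesis by (intro bexI[of _ y]) auto
  qed
  ultimately show "x \<in> G" by (meson closed_approachable)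
qed

text \<open>
  The attractor is the intersection of the iterated images of the unit interval. The nontrivial inclusion is that
  a point \<^term>\<open>x\<close> of the intersection has a preimage in the intersection: some fixed map is used at
  infinitely many levels, and its unique preimage of \<^term>\<open>x\<close> then lies in every level.
\<close>
lemma attractor_exists:
  assumes range: "0 < \<alpha>" "\<alpha> < 1" "0 < \<beta>" "\<beta> < 1" "0 < \<gamma>" "\<gamma> < (1::real)"
  shows "\<exists>F. is_attractor {0..1} (ifs \<alpha> \<beta> \<gamma>) F"
proof -
  define H where "H K = (\<Union>S\<in>ifs \<alpha> \<beta> \<gamma>. S ` K)" for K
  define K where "K n = (H ^^ n) {0..1}" for n
  have K_Suc: "K (Suc n) = H (K n)" for n by (simp add: K_def)
  have H_mono: "H A \<subseteq> H B" if "A \<subseteq> B" for A B using that unfolding H_def by blast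
  have "H {0..1} \<subseteq> {0..1}"
    unfolding H_def ifs_def using range
    by (auto intro!: mult_le_one add_nonneg_nonneg simp: mult_left_le)
  then have K01: "K 1 \<subseteq> K 0" by (simp add: K_def)
  have K_step: "K (Suc n) \<subseteq> K n" for n
  proof (induction n)
    case (Suc n)
    then show ?case unfolding K_Suc by (intro H_mono) (simp add: K_Suc)
  qed (use K01 in simp)
  then have K_dec: "K n \<subseteq> K m" if "m \<le> n" for m n using that by (rule lift_Suc_antimono_le)
  have K_compact: "compact (K n)" for n
  proof (induction n)
    case (Suc n)
    then have "compact (S ` K n)" if "S \<in> ifs \<alpha> \<beta> \<gamma>" for S
      using that by (intro compact_continuous_image) (auto simp: ifs_def intro!: continuous_intros)
    then show ?case unfolding K_Suc H_def by (intro compact_UN) (auto simp: ifs_def)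
  qed (simp add: K_def)
  have zero: "0 \<in> K n" for n
  proof (induction n)
    case (Suc n)
    then show ?case unfolding K_Suc H_def ifs_def by force
  qed (simp add: K_def)
  let ?F = "\<Inter>n. K n"
  have sub: "?F \<subseteq> H ?F"
  proof
    fix x assume x: "x \<in> ?F"
    have "\<forall>n. \<exists>S\<in>ifs \<alpha> \<beta> \<gamma>. x \<in> S ` K n"
      using x K_Suc unfolding H_def by blast
    then obtain T where T: "\<And>n. T n \<in> ifs \<alpha> \<beta> \<gamma>" "\<And>n. x \<in> T n ` K n" by metis
    have "finite (range T)" by (rule finite_subset[of _ "ifs \<alpha> \<beta> \<gamma>"]) (use T(1) in \<open>auto simp: ifs_def\<close>)
    then obtain m where inf: "infinite {n. T n = T m}"
      using pigeonhole_infinite[of UNIV T] by auto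
    have all: "x \<in> T m ` K n" for n
    proof -
      obtain k where "n \<le> k" "T k = T m" using inf unfolding infinite_nat_iff_unbounded_le by blast
      then show ?thesis using T(2)[of k] K_dec[of n k] by auto
    qed
    obtain \<rho> b where \<rho>: "\<rho> \<in> {\<alpha>, \<beta>, \<gamma>}" "T m = (\<lambda>x. \<rho> * x + b)" using T(1) by (rule ifs_cases)
    then have "\<rho> \<noteq> 0" using range by auto
    then have "(x - b) / \<rho> \<in> K n" for n using all[of n] \<rho>(2) by auto
    moreover have "x = T m ((x - b) / \<rho>)" using \<rho>(2) \<open>\<rho> \<noteq> 0\<close> by simp
    ultimately show "x \<in> H ?F" unfolding H_def using T(1) by blast
  qed
  have "H ?F \<subseteq> K n" for n
  proof -
    have "H ?F \<subseteq> H (K n)" by (rule H_mono) blast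
    then show ?thesis using K_step[of n] K_Suc by blast
  qed
  then have "?F = H ?F" using sub by blast
  moreover have "compact ?F" using K_compact by (intro compact_Inter) auto
  moreover have "K 0 = {0..1}" by (simp add: K_def)
  then have "?F \<subseteq> {0..1}" by blast
  moreover have "?F \<noteq> {}" using zero by blast
  ultimately have "is_attractor {0..1} (ifs \<alpha> \<beta> \<gamma>) ?F"
    unfolding is_attractor_def H_def[symmetric] by (intro conjI)
  then show ?thesis by blast
qed

section \<open>Similarity dimension\<close>

lemma powr_sum_strict_antimono:
  fixes \<alpha> \<beta> \<gamma> s t :: real
  assumes "0 < \<alpha>" "\<alpha> < 1" "0 < \<beta>" "\<beta> < 1" "0 < \<gamma>" "\<gamma> < 1" "s < t"
  shows "\<alpha> powr t + \<beta> powr t + \<gamma> powr t < \<alpha> powr s + \<beta> powr s + \<gamma> powr s"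
  using assms by (intro add_strict_mono powr_less_mono') auto

lemma similarity_dim_exists:
  fixes \<alpha> \<beta> \<gamma> :: real
  assumes "0 < \<alpha>" "\<alpha> < 1" "0 < \<beta>" "\<beta> < 1" "0 < \<gamma>" "\<gamma> < 1"
  shows "\<exists>s. \<alpha> powr s + \<beta> powr s + \<gamma> powr s = 1"
proof -
  have lim: "((\<lambda>s. a powr s) \<longlongrightarrow> 0) at_top" if "0 < a" "a < 1" for a :: real
  proof -
    have "filterlim (\<lambda>s::real. ln a * s) at_bot at_top"
      using that by (intro filterlim_tendsto_neg_mult_at_bot[OF tendsto_const]) (auto simp: filterlim_ident)
    then have "((\<lambda>s. exp (ln a * s)) \<longlongrightarrow> 0) at_top" by (rule filterlim_compose[OF exp_at_bot])
    then show ?thesis using that by (simp add: powr_def mult.commute)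
  qed
  have "((\<lambda>s. \<alpha> powr s + \<beta> powr s + \<gamma> powr s) \<longlongrightarrow> 0 + 0 + 0) at_top"
    using assms by (intro tendsto_add lim) auto
  then have "\<forall>\<^sub>F s in at_top. \<alpha> powr s + \<beta> powr s + \<gamma> powr s < 1"
    by (rule order_tendstoD) simp
  then have "\<forall>\<^sub>F s in at_top. \<alpha> powr s + \<beta> powr s + \<gamma> powr s < 1 \<and> 0 \<le> s"
    using eventually_ge_at_top by (rule eventually_conj)
  then obtain b where b: "\<alpha> powr b + \<beta> powr b + \<gamma> powr b < 1" "0 \<le> b"
    using eventually_happens'[of "at_top :: real filter"] trivial_limit_at_top_linorder by blast
  have "\<exists>s\<ge>0. s \<le> b \<and> \<alpha> powr s + \<beta> powr s + \<gamma> powr s = 1"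
    using assms b by (intro IVT2') (auto intro!: continuous_intros)
  then show ?thesis by blast
qed

lemma similarity_dim_unique:
  fixes \<alpha> \<beta> \<gamma> s t :: real
  assumes "0 < \<alpha>" "\<alpha> < 1" "0 < \<beta>" "\<beta> < 1" "0 < \<gamma>" "\<gamma> < 1"
    and "\<alpha> powr s + \<beta> powr s + \<gamma> powr s = 1" "\<alpha> powr t + \<beta> powr t + \<gamma> powr t = 1"
  shows "s = t"
  using powr_sum_strict_antimono[OF assms(1-6), of s t] powr_sum_strict_antimono[OF assms(1-6), of t s] assms(7,8)
  by (cases s t rule: linorder_cases) auto

lemma diameter_affine_image_le:
  fixes U :: "real set"
  assumes "bounded U" "0 \<le> \<rho>"
  shows "bounded ((\<lambda>x. \<rho> * x + b) ` U)" "diameter ((\<lambda>x. \<rho> * x + b) ` U) \<le> \<rho> * diameter U"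
proof -
  have d: "dist x y \<le> \<rho> * diameter U" if "x \<in> (\<lambda>x. \<rho> * x + b) ` U" "y \<in> (\<lambda>x. \<rho> * x + b) ` U" for x y
  proof -
    from that obtain u v where uv: "u \<in> U" "v \<in> U" "x = \<rho> * u + b" "y = \<rho> * v + b" by blast
    have "dist x y = \<rho> * dist u v"
      using uv assms(2) by (simp add: dist_real_def abs_mult flip: right_diff_distrib)
    also have "\<dots> \<le> \<rho> * diameter U"
      using uv assms by (intro mult_left_mono diameter_bounded_bound)
    finally show ?thesis .
  qed
  then show "bounded ((\<lambda>x. \<rho> * x + b) ` U)" unfolding bounded_two_points by blast
  show "diameter ((\<lambda>x. \<rho> * x + b) ` U) \<le> \<rho> * diameter U"
    using d assms diameter_ge_0[OF assms(1)] by (intro diameter_le_dist) auto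
qed

text \<open>
  For \<^term>\<open>t > s\<close> the images of the unit interval under all words of length \<^term>\<open>n\<close> have
  \<^term>\<open>t\<close>-dimensional sum \<^term>\<open>(\<alpha> powr t + \<beta> powr t + \<gamma> powr t) ^ n\<close>, which tends to 0.
\<close>
lemma hausdorff_dim_attractor_le:
  assumes F: "is_attractor {0..1} (ifs \<alpha> \<beta> \<gamma>) F"
    and range: "0 < \<alpha>" "\<alpha> < 1" "0 < \<beta>" "\<beta> < 1" "0 < \<gamma>" "\<gamma> < 1"
    and s: "\<alpha> powr s + \<beta> powr s + \<gamma> powr s = 1"
  shows "hausdorff_dim F \<le> ereal s"
proof (rule dense_ge)
  fix z assume "ereal s < z"
  then obtain t where t: "s < t" "ereal t < z" using ereal_dense2 less_ereal.simps(1) by metis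
  have "0 < s"
  proof (rule ccontr)
    assume "\<not> 0 < s"
    then have "\<alpha> powr 0 + \<beta> powr 0 + \<gamma> powr 0 \<le> \<alpha> powr s + \<beta> powr s + \<gamma> powr s"
      using powr_sum_strict_antimono[OF range, of s 0] by (cases "s = 0") auto
    then show False using s range by simp
  qed
  then have "0 < t" using t by simp
  define M where "M = Max {\<alpha>, \<beta>, \<gamma>}"
  have M: "0 < M" "M < 1" "\<And>\<rho>. \<rho> \<in> {\<alpha>, \<beta>, \<gamma>} \<Longrightarrow> \<rho> \<le> M" using range by (auto simp: M_def less_max_iff_disj)
  define q where "q = \<alpha> powr t + \<beta> powr t + \<gamma> powr t"
  have q: "0 \<le> q" "q < 1" using powr_sum_strict_antimono[OF range t(1)] s by (auto simp: q_def)
  have cover: "\<exists>us. F \<subseteq> \<Union>(set us) \<and> (\<forall>U\<in>set us. bounded U \<and> diameter U \<le> M ^ n) \<and>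
      (\<Sum>U\<leftarrow>us. diameter U powr t) \<le> q ^ n" for n
  proof (induction n)
    case 0
    have "F \<subseteq> {0..1}" using F by (simp add: is_attractor_def)
    then show ?case by (intro exI[of _ "[{0..1::real}]"]) auto
  next
    case (Suc n)
    then obtain us where us: "F \<subseteq> \<Union>(set us)" "\<And>U. U \<in> set us \<Longrightarrow> bounded U"
      "\<And>U. U \<in> set us \<Longrightarrow> diameter U \<le> M ^ n" "(\<Sum>U\<leftarrow>us. diameter U powr t) \<le> q ^ n" by blast
    define im where "im \<rho> b = map (\<lambda>U. (\<lambda>x. \<rho> * x + b) ` U) us" for \<rho> b :: real
    have im_sum: "(\<Sum>U\<leftarrow>im \<rho> b. diameter U powr t) \<le> \<rho> powr t * q ^ n" if "0 < \<rho>" for \<rho> b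
    proof -
      have "(\<Sum>U\<leftarrow>im \<rho> b. diameter U powr t) = (\<Sum>U\<leftarrow>us. diameter ((\<lambda>x. \<rho> * x + b) ` U) powr t)"
        by (simp add: im_def comp_def)
      also have "\<dots> \<le> (\<Sum>U\<leftarrow>us. \<rho> powr t * diameter U powr t)"
      proof (rule sum_list_mono)
        fix U assume "U \<in> set us"
        then have U: "bounded U" by (rule us(2))
        have "diameter ((\<lambda>x. \<rho> * x + b) ` U) powr t \<le> (\<rho> * diameter U) powr t"
          using diameter_affine_image_le[OF U, of \<rho> b] that \<open>0 < t\<close> diameter_ge_0
          by (intro powr_mono2) auto
        then show "diameter ((\<lambda>x. \<rho> * x + b) ` U) powr t \<le> \<rho> powr t * diameter U powr t"
          by (simp add: powr_mult)
      qed
      also have "\<dots> = \<rho> powr t * (\<Sum>U\<leftarrow>us. diameter U powr t)" by (rule sum_list_const_mult)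
      also have "\<dots> \<le> \<rho> powr t * q ^ n" using us(4) by (intro mult_left_mono) auto
      finally show ?thesis .
    qed
    have im_diam: "bounded V \<and> diameter V \<le> M ^ Suc n" if V: "V \<in> set (im \<rho> b)" and \<rho>: "\<rho> \<in> {\<alpha>, \<beta>, \<gamma>}" for V \<rho> b
    proof -
      from V obtain U where U: "U \<in> set us" "V = (\<lambda>x. \<rho> * x + b) ` U" by (auto simp: im_def)
      have "0 \<le> \<rho>" using \<rho> range by auto
      then have "bounded V" "diameter V \<le> \<rho> * diameter U"
        using diameter_affine_image_le[OF us(2)[OF U(1)]] U(2) by auto
      moreover have "\<rho> * diameter U \<le> M * M ^ n"
        using M \<rho> us(2,3)[OF U(1)] diameter_ge_0 by (intro mult_mono) auto
      ultimately show ?thesis by simp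
    qed
    let ?us = "im \<alpha> 0 @ im \<beta> 0 @ im \<gamma> (1 - \<gamma>)"
    have "F \<subseteq> \<Union>(set ?us)"
    proof
      fix x assume "x \<in> F"
      with F obtain S y where S: "S \<in> ifs \<alpha> \<beta> \<gamma>" "y \<in> F" "x = S y" by (rule attractor_ex_preimage)
      obtain U where "U \<in> set us" "y \<in> U" using us(1) S(2) by blast
      then show "x \<in> \<Union>(set ?us)" using S(1,3) by (auto simp: ifs_def im_def)
    qed
    moreover have "(\<Sum>U\<leftarrow>?us. diameter U powr t) \<le> q ^ Suc n"
      using im_sum[of \<alpha> 0] im_sum[of \<beta> 0] im_sum[of \<gamma> "1 - \<gamma>"] range by (simp add: q_def algebra_simps)
    moreover have "\<forall>U\<in>set ?us. bounded U \<and> diameter U \<le> M ^ Suc n"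
    proof
      fix V assume "V \<in> set ?us"
      then show "bounded V \<and> diameter V \<le> M ^ Suc n"
        using im_diam[of V \<alpha> 0] im_diam[of V \<beta> 0] im_diam[of V \<gamma> "1 - \<gamma>"] by auto
    qed
    ultimately show ?case by blast
  qed
  have "hausdorff_measure t F = 0"
  proof (rule hausdorff_measure_eq_0I[OF \<open>0 < t\<close>])
    fix \<delta> e :: real assume "0 < \<delta>" "0 < e"
    obtain n where n: "(max M q) ^ n < min \<delta> e"
      using real_arch_pow_inv[of "min \<delta> e" "max M q"] \<open>0 < \<delta>\<close> \<open>0 < e\<close> M q by auto
    have "M ^ n \<le> (max M q) ^ n" "q ^ n \<le> (max M q) ^ n" using M(1) q(1) by (auto intro!: power_mono)
    with n have "M ^ n \<le> \<delta>" "q ^ n \<le> e" by auto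
    then show "\<exists>us. F \<subseteq> \<Union>(set us) \<and> (\<forall>U\<in>set us. bounded U \<and> diameter U \<le> \<delta>) \<and>
      (\<Sum>U\<leftarrow>us. diameter U powr t) \<le> e" using cover[of n] by (meson order_trans)
  qed
  then have "hausdorff_dim F \<le> ereal t" using \<open>0 < t\<close> by (intro hausdorff_dim_le) simp
  then show "hausdorff_dim F \<le> z" using t(2) by simp
qed

text \<open>
  Following the address of \<^term>\<open>x\<close> until the contraction ratio first drops to \<^term>\<open>R\<close> gives a cylinder
  around \<^term>\<open>x\<close> of ratio between \<^term>\<open>Min {\<alpha>, \<beta>, \<gamma>} * R\<close> and \<^term>\<open>R\<close>. Since the attractor has
  diameter at most 1, this cylinder lies in the ball.
\<close>
lemma attractor_has_copies_in_balls:
  assumes F: "is_attractor {0..1} (ifs \<alpha> \<beta> \<gamma>) F"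
    and range: "0 < \<alpha>" "\<alpha> < 1" "0 < \<beta>" "\<beta> < 1" "0 < \<gamma>" "\<gamma> < 1"
  shows "has_copies_in_balls (Min {\<alpha>, \<beta>, \<gamma>}) F"
proof -
  define c where "c = Min {\<alpha>, \<beta>, \<gamma>}"
  define M where "M = Max {\<alpha>, \<beta>, \<gamma>}"
  have M: "0 < M" "M < 1" "\<And>\<rho>. \<rho> \<in> {\<alpha>, \<beta>, \<gamma>} \<Longrightarrow> \<rho> \<le> M" using range by (auto simp: M_def less_max_iff_disj)
  have c: "0 < c" "c < 1" "\<And>\<rho>. \<rho> \<in> {\<alpha>, \<beta>, \<gamma>} \<Longrightarrow> c \<le> \<rho>" using range by (auto simp: c_def min_less_iff_disj)
  \<comment> \<open>The upper bound on \<^term>\<open>R\<close> exceeds 1, since one step of the recursion can divide \<^term>\<open>R\<close> by a ratio smaller than \<^term>\<open>R\<close>; the identity copy then still satisfies \<^term>\<open>c * R \<le> 1\<close>.\<close>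
  have copy: "\<exists>\<rho> b z. c * R \<le> \<rho> \<and> 0 \<le> \<rho> \<and> \<rho> \<le> R \<and> z \<in> F \<and> x = \<rho> * z + b \<and> (\<forall>y\<in>F. \<rho> * y + b \<in> F)"
    if "x \<in> F" "M ^ n < R" "R \<le> 1 / c" for n x R
    using that
  proof (induction n arbitrary: x R)
    case 0
    then show ?case using c by (intro exI[of _ 1] exI[of _ 0] exI[of _ x]) (auto simp: field_simps)
  next
    case (Suc n)
    show ?case
    proof (cases "1 \<le> R")
      case True
      then show ?thesis using c Suc.prems by (intro exI[of _ 1] exI[of _ 0] exI[of _ x]) (auto simp: field_simps)
    next
      case False
      from F Suc.prems(1) obtain S x' where S: "S \<in> ifs \<alpha> \<beta> \<gamma>" "x' \<in> F" "x = S x'" by (rule attractor_ex_preimage)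
      from S(1) obtain \<rho>\<^sub>1 b\<^sub>1 where \<rho>\<^sub>1: "\<rho>\<^sub>1 \<in> {\<alpha>, \<beta>, \<gamma>}" "S = (\<lambda>x. \<rho>\<^sub>1 * x + b\<^sub>1)" by (rule ifs_cases)
      have pos: "0 < \<rho>\<^sub>1" "\<rho>\<^sub>1 \<le> M" "c \<le> \<rho>\<^sub>1" using c M \<rho>\<^sub>1(1) range by auto
      have "\<rho>\<^sub>1 * M ^ n \<le> M * M ^ n" using pos M(1) by (intro mult_right_mono) auto
      also have "\<dots> < R" using Suc.prems(2) by simp
      finally have "M ^ n < R / \<rho>\<^sub>1" using pos(1) by (simp add: field_simps)
      moreover have "R / \<rho>\<^sub>1 \<le> 1 / c" using False pos c(1) Suc.prems(2) M(1)
        by (intro frac_le) auto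
      ultimately obtain \<rho> b z where IH: "c * (R / \<rho>\<^sub>1) \<le> \<rho>" "0 \<le> \<rho>" "\<rho> \<le> R / \<rho>\<^sub>1" "z \<in> F" "x' = \<rho> * z + b"
        "\<And>y. y \<in> F \<Longrightarrow> \<rho> * y + b \<in> F"
        using Suc.IH[OF S(2)] by blast
      have "\<rho>\<^sub>1 * \<rho> * y + (\<rho>\<^sub>1 * b + b\<^sub>1) \<in> F" if "y \<in> F" for y
        using attractor_image_mem[OF F S(1) IH(6)[OF that]] \<rho>\<^sub>1(2) by (simp add: algebra_simps)
      moreover have "c * R \<le> \<rho>\<^sub>1 * \<rho>" "\<rho>\<^sub>1 * \<rho> \<le> R" using IH(1,3) pos(1) by (auto simp: field_simps)
      moreover have "x = \<rho>\<^sub>1 * \<rho> * z + (\<rho>\<^sub>1 * b + b\<^sub>1)" using IH(5) S(3) \<rho>\<^sub>1(2) by (simp add: algebra_simps)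
      moreover have "0 \<le> \<rho>\<^sub>1 * \<rho>" using pos(1) IH(2) by simp
      ultimately show ?thesis using IH(4) by blast
    qed
  qed
  have "has_copies_in_balls c F"
    unfolding has_copies_in_balls_def
  proof (intro ballI)
    fix x R :: real assume x: "x \<in> F" and R: "R \<in> {0<..1}"
    obtain n where "M ^ n < R" using R real_arch_pow_inv[of R M] M(2) by auto
    moreover have "1 \<le> 1 / c" using c by simp
    then have "R \<le> 1 / c" using R by simp
    ultimately obtain \<rho> b z where \<rho>: "c * R \<le> \<rho>" "0 \<le> \<rho>" "\<rho> \<le> R" "z \<in> F" "x = \<rho> * z + b"
        "\<And>y. y \<in> F \<Longrightarrow> \<rho> * y + b \<in> F" using copy[OF x] by blast
    have affine: "dist (\<rho> * y + b) (\<rho> * y' + b) = \<rho> * dist y y'" for y y'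
      using \<rho>(2) by (simp add: dist_real_def abs_mult flip: right_diff_distrib)
    have "\<rho> * y + b \<in> cball x R" if "y \<in> F" for y
    proof -
      have "y \<in> {0..1}" "z \<in> {0..1}" using that \<rho>(4) F unfolding is_attractor_def by blast+
      then have "dist z y \<le> 1" by (auto simp: dist_real_def)
      then have "\<rho> * dist z y \<le> R * 1" using \<rho> R by (intro mult_mono) auto
      then show ?thesis by (simp only: \<rho>(5) mem_cball affine mult_1_right)
    qed
    then have "(\<lambda>y. \<rho> * y + b) ` F \<subseteq> F \<inter> cball x R" using \<rho>(6) by blast
    moreover have "\<forall>y\<in>F. \<forall>z\<in>F. c * R * dist y z \<le> dist (\<rho> * y + b) (\<rho> * z + b)"
      unfolding affine using \<rho>(1) by (intro ballI mult_right_mono) auto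
    ultimately show "\<exists>g. g ` F \<subseteq> F \<inter> cball x R \<and> (\<forall>y\<in>F. \<forall>z\<in>F. c * R * dist y z \<le> dist (g y) (g z))" by blast
  qed
  then show ?thesis by (simp add: c_def)
qed

section \<open>Assouad dimension\<close>

text \<open>
  An interval of length \<^term>\<open>2 * R\<close> is covered by intervals of length \<^term>\<open>r\<close>, overlapping by half of their
  length because they have to be open.
\<close>
lemma assouad_dim_real_le_1:
  fixes F :: "real set"
  shows "assouad_dim F \<le> 1"
proof -
  have cov: "ereal_of_enat (covering_number r (cball x R \<inter> F)) \<le> ereal (5 * (R / r))" if "0 < r" "r < R" for x r R
  proof -
    define h where "h = r / 2"
    have "0 < h" using that by (simp add: h_def)
    define n where "n = nat \<lfloor>2 * R / h\<rfloor>"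
    let ?B = "\<lambda>k. ball (x - R + real k * h) h"
    have "cball x R \<inter> F \<subseteq> \<Union>(?B ` {..n})"
    proof
      fix y assume "y \<in> cball x R \<inter> F"
      then have y: "0 \<le> y - x + R" "y - x + R \<le> 2 * R" by (auto simp: dist_real_def)
      define k where "k = nat \<lfloor>(y - x + R) / h\<rfloor>"
      have k: "real k \<le> (y - x + R) / h" "(y - x + R) / h < real k + 1"
        using y \<open>0 < h\<close> by (auto simp: k_def)
      have "(y - x + R) / h \<le> 2 * R / h" using y \<open>0 < h\<close> by (intro divide_right_mono) auto
      then have "k \<le> n" unfolding k_def n_def by (intro nat_mono floor_mono)
      moreover have "y \<in> ?B k"
        using k \<open>0 < h\<close> by (simp add: dist_real_def abs_less_iff field_simps)
      ultimately show "y \<in> \<Union>(?B ` {..n})" by blast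
    qed
    moreover have "open U \<and> bounded U \<and> diameter U \<le> r" if U: "U \<in> ?B ` {..n}" for U
    proof -
      from U obtain k where "U = ?B k" by blast
      then show ?thesis using diameter_ball_le[of h "x - R + real k * h"] \<open>0 < h\<close> by (simp add: h_def)
    qed
    ultimately have "covering_number r (cball x R \<inter> F) \<le> enat (card (?B ` {..n}))"
      by (intro covering_number_le) auto
    also have "\<dots> \<le> enat (Suc n)" using card_image_le[of "{..n}" ?B] by simp
    finally have "ereal_of_enat (covering_number r (cball x R \<inter> F)) \<le> ereal_of_enat (enat (Suc n))"
      by (simp only: ereal_of_enat_le_iff)
    moreover have "0 \<le> 2 * R / h" using that \<open>0 < h\<close> by simp
    then have "real n \<le> 2 * R / h" unfolding n_def by linarith
    then have "real (Suc n) \<le> 5 * (R / r)" using that by (simp add: h_def field_simps)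
    ultimately show ?thesis by (auto intro: order_trans)
  qed
  have "assouad_dim F \<le> ereal 1"
    unfolding assouad_dim_def
  proof (rule INF_lower, intro CollectI exI conjI allI impI)
    show "(0::real) < 5" "(0::real) < 1" by simp_all
    fix r R :: real assume "0 < r \<and> r < R \<and> R \<le> 1"
    then show "(SUP x\<in>F. ereal_of_enat (covering_number r (cball x R \<inter> F))) \<le> ereal (5 * (R / r) powr 1)"
      using cov by (intro SUP_least) simp
  qed
  then show ?thesis by (simp add: one_ereal_def)
qed

text \<open>
  Irrationality of \<^term>\<open>ln \<beta> / ln \<alpha>\<close> makes the integer combinations of \<^term>\<open>ln \<alpha>\<close> and \<^term>\<open>ln \<beta>\<close> dense
  by Kronecker's theorem; the claim is the exponential of this.
\<close>
lemma powr_products_dense: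
  fixes \<alpha> \<beta> y \<eta> :: real
  assumes "0 < \<alpha>" "\<alpha> < 1" "0 < \<beta>" "ln \<beta> / ln \<alpha> \<notin> \<rat>" "0 < y" "0 < \<eta>"
  shows "\<exists>m n :: int. \<bar>\<alpha> powr of_int m * \<beta> powr of_int n - y\<bar> < \<eta>"
proof -
  have "ln \<alpha> \<noteq> 0" using assms by simp
  let ?x = "ln y / ln \<alpha>"
  have "isCont (\<lambda>u. exp (ln \<alpha> * u)) ?x" by (intro continuous_intros)
  then obtain e where e: "0 < e" "\<And>u. \<bar>u - ?x\<bar> < e \<Longrightarrow> \<bar>exp (ln \<alpha> * u) - exp (ln \<alpha> * ?x)\<bar> < \<eta>"
    using assms(6) unfolding continuous_at_eps_delta dist_real_def by metis
  obtain h k :: int where hk: "\<bar>of_int k * (ln \<beta> / ln \<alpha>) - of_int h - ?x\<bar> < e"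
    using sequence_of_fractional_parts_is_dense[OF assms(4) e(1)] by metis
  have "ln \<alpha> * (of_int k * (ln \<beta> / ln \<alpha>) - of_int h) = of_int (- h) * ln \<alpha> + of_int k * ln \<beta>"
    using \<open>ln \<alpha> \<noteq> 0\<close> by (simp add: field_simps)
  then have "exp (ln \<alpha> * (of_int k * (ln \<beta> / ln \<alpha>) - of_int h)) = \<alpha> powr of_int (- h) * \<beta> powr of_int k"
    using assms by (simp only: powr_def exp_add) simp
  moreover have "exp (ln \<alpha> * ?x) = y" using \<open>ln \<alpha> \<noteq> 0\<close> assms(5) by simp
  ultimately show ?thesis using e(2)[OF hk] by metis
qed

text \<open>
  The points 0 and 1 are the fixed points of the contractions, and products of powers are images of 1 under the
  maps fixing 0.
\<close>
lemma attractor_contains_products: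
  assumes F: "is_attractor {0..1} (ifs \<alpha> \<beta> \<gamma>) F"
    and range: "0 < \<alpha>" "\<alpha> < 1" "0 < \<beta>" "\<beta> < 1" "0 < \<gamma>" "\<gamma> < 1"
  shows "0 \<in> F" "\<alpha> ^ m * \<beta> ^ n \<in> F"
proof -
  have closed: "closed F" using F by (simp add: is_attractor_def compact_imp_closed)
  have S: "\<alpha> * x \<in> F" "\<beta> * x \<in> F" "\<gamma> * x + (1 - \<gamma>) \<in> F" if "x \<in> F" for x
    using attractor_image_mem[OF F _ that, of "\<lambda>x. \<alpha> * x"] attractor_image_mem[OF F _ that, of "\<lambda>x. \<beta> * x"]
      attractor_image_mem[OF F _ that, of "\<lambda>x. \<gamma> * x + (1 - \<gamma>)"] by (auto simp: ifs_def)
  obtain x where x: "x \<in> F" using F unfolding is_attractor_def by blast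
  have "\<alpha> ^ k * x \<in> F" for k
    by (induction k) (use x S(1) in \<open>auto simp: mult.assoc\<close>)
  moreover have "(\<lambda>k. \<alpha> ^ k * x) \<longlonglongrightarrow> 0 * x"
    using range by (intro tendsto_mult tendsto_const LIMSEQ_realpow_zero) auto
  ultimately show "0 \<in> F" using closed_sequentially[OF closed, of "\<lambda>k. \<alpha> ^ k * x"] by simp
  have mem: "1 - \<gamma> ^ k * (1 - x) \<in> F" for k
  proof (induction k)
    case (Suc k)
    then show ?case using S(3)[OF Suc] by (simp add: algebra_simps)
  qed (use x in simp)
  have "(\<lambda>k. 1 - \<gamma> ^ k * (1 - x)) \<longlonglongrightarrow> 1 - 0 * (1 - x)"
    using range by (intro tendsto_diff tendsto_mult tendsto_const LIMSEQ_realpow_zero) auto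
  then have "1 \<in> F" using closed_sequentially[OF closed, of "\<lambda>k. 1 - \<gamma> ^ k * (1 - x)"] mem by simp
  then have "\<beta> ^ n \<in> F" by (induction n) (use S(2) in auto)
  then show "\<alpha> ^ m * \<beta> ^ n \<in> F" by (induction m) (use S(1) in \<open>auto simp: mult.assoc\<close>)
qed

text \<open>
  The products approximating a grid may have negative exponents. There are finitely many of them, so a power of
  \<^term>\<open>\<alpha> * \<beta>\<close> makes all exponents nonnegative; this only rescales the picture about 0. Thus the interval
  \<^term>\<open>{0..1::real}\<close> is a limit of blow-ups of the attractor at 0.
\<close>
lemma attractor_contains_scaled_grid:
  assumes F: "is_attractor {0..1} (ifs \<alpha> \<beta> \<gamma>) F"
    and range: "0 < \<alpha>" "\<alpha> < 1" "0 < \<beta>" "\<beta> < 1" "0 < \<gamma>" "\<gamma> < 1"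
    and irrational: "ln \<beta> / ln \<alpha> \<notin> \<rat>"
  shows "\<exists>y N. (\<forall>j<J. \<bar>y j - real (Suc j) / real (Suc J)\<bar> < 1 / (4 * real (Suc J))) \<and>
    (\<forall>T\<ge>N. \<forall>j<J. (\<alpha> * \<beta>) ^ T * y j \<in> F)"
proof -
  have "\<exists>m n :: int. \<bar>\<alpha> powr of_int m * \<beta> powr of_int n - real (Suc j) / real (Suc J)\<bar> < 1 / (4 * real (Suc J))" for j
    using range by (intro powr_products_dense irrational) auto
  then obtain m n :: "nat \<Rightarrow> int" where mn:
    "\<And>j. \<bar>\<alpha> powr of_int (m j) * \<beta> powr of_int (n j) - real (Suc j) / real (Suc J)\<bar> < 1 / (4 * real (Suc J))"
    by metis
  define y where "y j = \<alpha> powr of_int (m j) * \<beta> powr of_int (n j)" for j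
  define N where "N = (\<Sum>j<J. nat \<bar>m j\<bar> + nat \<bar>n j\<bar>)"
  have "(\<alpha> * \<beta>) ^ T * y j \<in> F" if "N \<le> T" "j < J" for T j
  proof -
    have "nat \<bar>m j\<bar> + nat \<bar>n j\<bar> \<le> N" unfolding N_def using that(2) by (intro member_le_sum) auto
    then have nn: "0 \<le> int T + m j" "0 \<le> int T + n j" using that(1) by linarith+
    have shift: "a ^ T * a powr of_int i = a ^ nat (int T + i)" if "0 < a" "0 \<le> int T + i" for a :: real and i
    proof -
      have "a ^ nat (int T + i) = a powr real (nat (int T + i))" by (simp only: powr_realpow[OF that(1)])
      also have "real (nat (int T + i)) = real T + of_int i"
        using that(2) by (metis int_nat_eq of_int_add of_int_of_nat_eq)
      also have "a powr (real T + of_int i) = a ^ T * a powr of_int i" using that by (simp add: powr_add powr_realpow)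
      finally show ?thesis by simp
    qed
    have "(\<alpha> * \<beta>) ^ T * y j = (\<alpha> ^ T * \<alpha> powr of_int (m j)) * (\<beta> ^ T * \<beta> powr of_int (n j))"
      by (simp add: y_def power_mult_distrib mult_ac)
    also have "\<dots> = \<alpha> ^ nat (int T + m j) * \<beta> ^ nat (int T + n j)"
      using shift nn range by simp
    also have "\<dots> \<in> F" by (rule attractor_contains_products(2)[OF F range])
    finally show ?thesis .
  qed
  moreover have "\<bar>y j - real (Suc j) / real (Suc J)\<bar> < 1 / (4 * real (Suc J))" for j
    unfolding y_def by (rule mn)
  ultimately show ?thesis by blast
qed

text \<open>
  In the ball of radius \<^term>\<open>(\<alpha> * \<beta>) ^ T\<close> about 0 the scaled grid consists of \<^term>\<open>J\<close> points at mutual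
  distance more than the \<^term>\<open>2 * Suc J\<close>-th part of the radius, for arbitrarily small radii.
\<close>
lemma card_grid_le_of_assouad_bound:
  assumes F: "is_attractor {0..1} (ifs \<alpha> \<beta> \<gamma>) F"
    and range: "0 < \<alpha>" "\<alpha> < 1" "0 < \<beta>" "\<beta> < 1" "0 < \<gamma>" "\<gamma> < 1"
    and irrational: "ln \<beta> / ln \<alpha> \<notin> \<rat>" and "0 < \<rho>"
    and bound: "\<And>r R. 0 < r \<Longrightarrow> r < R \<Longrightarrow> R \<le> \<rho> \<Longrightarrow>
      (SUP x\<in>F. ereal_of_enat (covering_number r (cball x R \<inter> F))) \<le> ereal (C * (R / r) powr a)"
  shows "real J \<le> C * (2 * real (Suc J)) powr a"
proof -
  obtain y N where y: "\<And>j. j < J \<Longrightarrow> \<bar>y j - real (Suc j) / real (Suc J)\<bar> < 1 / (4 * real (Suc J))"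
    and mem: "\<And>T j. N \<le> T \<Longrightarrow> j < J \<Longrightarrow> (\<alpha> * \<beta>) ^ T * y j \<in> F"
    using attractor_contains_scaled_grid[OF F range irrational, of J] by blast
  have ab: "0 < \<alpha> * \<beta>" "\<alpha> * \<beta> < 1" using range mult_strict_mono[of \<alpha> 1 \<beta> 1] by auto
  obtain T0 where T0: "(\<alpha> * \<beta>) ^ T0 < \<rho>" using real_arch_pow_inv[OF \<open>0 < \<rho>\<close> ab(2)] by blast
  define T where "T = max N T0"
  define R where "R = (\<alpha> * \<beta>) ^ T"
  define r where "r = R / (2 * real (Suc J))"
  have "(\<alpha> * \<beta>) ^ T \<le> (\<alpha> * \<beta>) ^ T0" using ab by (intro power_decreasing) (auto simp: T_def)
  then have R: "0 < R" "R \<le> \<rho>" using ab(1) T0 zero_less_power[OF ab(1), of T] unfolding R_def by linarith+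
  then have r: "0 < r" "r < R" by (auto simp: r_def field_simps intro!: add_pos_nonneg)
  have sep: "r < dist (R * y j) (R * y k)" if jk: "j < J" "k < J" "j < k" for j k
  proof -
    have "real (Suc k) / real (Suc J) - real (Suc j) / real (Suc J) = real (k - j) / real (Suc J)"
      using jk by (simp flip: diff_divide_distrib)
    also have "\<dots> \<ge> 1 / real (Suc J)" using jk by (intro divide_right_mono) auto
    finally have gap: "1 / real (Suc J) \<le> real (Suc k) / real (Suc J) - real (Suc j) / real (Suc J)" .
    define h where "h = 1 / (4 * real (Suc J))"
    define p where "p i = real (Suc i) / real (Suc J)" for i
    have h: "1 / real (Suc J) = 4 * h" "1 / (2 * real (Suc J)) = 2 * h"
      by (simp_all add: h_def field_simps)
    have "4 * h \<le> p k - p j" using gap by (simp only: h p_def)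
    moreover have "\<bar>y j - p j\<bar> < h" "\<bar>y k - p k\<bar> < h" using y jk by (simp_all only: h_def p_def)
    ultimately have "2 * h < \<bar>y j - y k\<bar>" by linarith
    then have "1 / (2 * real (Suc J)) < \<bar>y j - y k\<bar>" by (simp only: h)
    then have "R * (1 / (2 * real (Suc J))) < R * \<bar>y j - y k\<bar>" using R(1) by (intro mult_strict_left_mono)
    also have "\<dots> = dist (R * y j) (R * y k)" using R(1) by (simp add: dist_real_def abs_mult flip: right_diff_distrib)
    finally show ?thesis by (simp add: r_def)
  qed
  have sep': "r < dist (R * y j) (R * y k)" if "j < J" "k < J" "j \<noteq> k" for j k
    using that sep[of j k] sep[of k j] by (cases "j < k") (auto simp: dist_commute)
  let ?P = "(\<lambda>j. R * y j) ` {..<J}"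
  have "inj_on (\<lambda>j. R * y j) {..<J}"
  proof (rule inj_onI, rule ccontr)
    fix j k assume "j \<in> {..<J}" "k \<in> {..<J}" "R * y j = R * y k" "j \<noteq> k"
    then have "r < dist (R * y k) (R * y k)" using sep'[of j k] by (metis lessThan_iff)
    then show False using r(1) by simp
  qed
  then have card: "card ?P = J" by (simp add: card_image)
  have "enat (card ?P) \<le> covering_number r (cball 0 R \<inter> F)"
  proof (rule card_separated_le_covering_number)
    show "?P \<subseteq> cball 0 R \<inter> F"
    proof
      fix p assume "p \<in> ?P"
      then obtain j where j: "j < J" "p = R * y j" by blast
      define h where "h = 1 / (4 * real (Suc J))"
      define u where "u = real (Suc j) / real (Suc J)"
      have "h \<le> u" by (simp add: h_def u_def field_simps)
      moreover have "u = 4 * real (Suc j) / (4 * real (Suc J))" by (simp add: u_def field_simps)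
      then have "u + h = (4 * real (Suc j) + 1) / (4 * real (Suc J))"
        by (simp only: h_def add_divide_distrib)
      then have "u + h \<le> 1" using j(1) by (simp only: divide_le_eq_1_pos) simp
      moreover have "\<bar>y j - u\<bar> < h" using y[OF j(1)] by (simp only: h_def u_def)
      ultimately have "0 \<le> y j" "y j \<le> 1" by linarith+
      then have "p \<in> cball 0 R" using R(1) j(2) by (simp add: mult_left_le)
      then show "p \<in> cball 0 R \<inter> F" using mem[of T j] j by (simp add: T_def R_def)
    qed
    fix p q assume "p \<in> ?P" "q \<in> ?P" "p \<noteq> q"
    then show "r < dist p q" using sep' by blast
  qed simp
  then have "ereal (real J) \<le> ereal_of_enat (covering_number r (cball 0 R \<inter> F))"
    unfolding card by (metis ereal_of_enat_le_iff ereal_of_enat_simps(1))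
  also have "\<dots> \<le> (SUP x\<in>F. ereal_of_enat (covering_number r (cball x R \<inter> F)))"
    using attractor_contains_products(1)[OF F range] by (rule SUP_upper)
  also have "\<dots> \<le> ereal (C * (R / r) powr a)" using bound r R by blast
  also have "R / r = 2 * real (Suc J)" using R(1) by (simp add: r_def)
  finally show ?thesis by simp
qed

lemma one_le_exponent_of_linear_growth:
  fixes a C :: real
  assumes "0 < C" "\<And>J :: nat. real J \<le> C * (2 * real (Suc J)) powr a"
  shows "1 \<le> a"
proof (rule ccontr)
  assume "\<not> 1 \<le> a"
  then have a: "0 < 1 - a" by simp
  obtain J :: nat where J: "max 1 ((4 * C) powr (1 / (1 - a))) < real J" using reals_Archimedean2 by blast
  let ?n = "2 * real (Suc J)"
  have "4 * C = ((4 * C) powr (1 / (1 - a))) powr (1 - a)" using a assms(1) by (simp add: powr_powr)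
  also have "\<dots> < ?n powr (1 - a)" using J a by (intro powr_less_mono2) auto
  finally have "4 * C * ?n powr a < ?n powr (1 - a) * ?n powr a" by (intro mult_strict_right_mono) auto
  also have "\<dots> = ?n" by (simp flip: powr_add)
  also have "\<dots> \<le> 4 * real J" using J by simp
  finally show False using assms(2)[of J] by simp
qed

lemma assouad_dim_attractor:
  assumes F: "is_attractor {0..1} (ifs \<alpha> \<beta> \<gamma>) F"
    and range: "0 < \<alpha>" "\<alpha> < 1" "0 < \<beta>" "\<beta> < 1" "0 < \<gamma>" "\<gamma> < 1"
    and irrational: "ln \<beta> / ln \<alpha> \<notin> \<rat>"
  shows "assouad_dim F = 1"
proof (rule antisym[OF assouad_dim_real_le_1])
  show "1 \<le> assouad_dim F"
    unfolding assouad_dim_def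
  proof (rule INF_greatest, clarify)
    fix a C \<rho> :: real
    assume C: "0 < C" "0 < \<rho>" "\<forall>r R. 0 < r \<and> r < R \<and> R \<le> \<rho> \<longrightarrow>
      (SUP x\<in>F. ereal_of_enat (covering_number r (cball x R \<inter> F))) \<le> ereal (C * (R / r) powr a)"
    have "real J \<le> C * (2 * real (Suc J)) powr a" for J
      by (rule card_grid_le_of_assouad_bound[OF F range irrational C(2)]) (use C(3) in blast)
    then have "1 \<le> a" by (rule one_le_exponent_of_linear_growth[OF C(1)])
    then show "1 \<le> ereal a" by (simp add: one_ereal_def)
  qed
qed

section \<open>Small similarity dimension\<close>

text \<open>
  With \<^term>\<open>\<gamma> = \<alpha>\<close> and \<^term>\<open>\<beta> = \<alpha> powr \<theta>\<close> for an irrational \<^term>\<open>\<theta> > 1\<close> it suffices that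
  \<^term>\<open>\<alpha> powr \<epsilon> < 1 / 3\<close>; the choice below makes this number \<^term>\<open>exp (- 3 :: real)\<close>.
\<close>
lemma small_similarity_dim:
  fixes \<epsilon> :: real
  assumes "0 < \<epsilon>"
  shows "\<exists>\<alpha>\<in>{0<..<1::real}. \<exists>\<beta>\<in>{0<..<1::real}. \<exists>\<gamma>\<in>{0<..<1::real}. ln \<beta> / ln \<alpha> \<notin> \<rat> \<and>
    (\<exists>s::real. \<alpha> powr s + \<beta> powr s + \<gamma> powr s = 1 \<and> s < \<epsilon>)"
proof -
  obtain \<theta> :: real where \<theta>: "\<theta> \<in> {1<..<2}" "\<theta> \<notin> \<rat>"
    using open_minus_countable[OF countable_rat, of "{1<..<2::real}"] by auto
  define \<alpha> where "\<alpha> = exp (- (3 / \<epsilon>))"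
  define \<beta> where "\<beta> = exp (- (3 / \<epsilon>) * \<theta>)"
  have range: "0 < \<alpha>" "\<alpha> < 1" "0 < \<beta>" "\<beta> < 1" using assms \<theta>(1) by (auto simp: \<alpha>_def \<beta>_def)
  have "ln \<beta> / ln \<alpha> = \<theta>" using assms by (simp add: \<alpha>_def \<beta>_def)
  obtain s where s: "\<alpha> powr s + \<beta> powr s + \<alpha> powr s = 1"
    using similarity_dim_exists[of \<alpha> \<beta> \<alpha>] range by blast
  have "exp (3::real) \<ge> 1 + 3" by (rule exp_ge_add_one_self)
  then have "exp (- 3 :: real) \<le> 1 / 4" by (simp add: exp_minus field_simps)
  moreover have "\<alpha> powr \<epsilon> = exp (- 3)" using assms by (simp add: \<alpha>_def powr_def)
  moreover have "\<beta> \<le> \<alpha>" using \<theta>(1) assms by (simp add: \<alpha>_def \<beta>_def divide_right_mono)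
  then have "\<beta> powr \<epsilon> \<le> \<alpha> powr \<epsilon>" using range assms by (intro powr_mono2) auto
  ultimately have lt: "\<alpha> powr \<epsilon> + \<beta> powr \<epsilon> + \<alpha> powr \<epsilon> < 1" by linarith
  have "s < \<epsilon>"
  proof (rule ccontr)
    assume "\<not> s < \<epsilon>"
    then have "\<epsilon> = s \<or> \<epsilon> < s" by auto
    then show False using powr_sum_strict_antimono[of \<alpha> \<beta> \<alpha> \<epsilon> s] range s lt by auto
  qed
  then show ?thesis using range s \<theta>(2) \<open>ln \<beta> / ln \<alpha> = \<theta>\<close>
    by (intro bexI[of _ \<alpha>] bexI[of _ \<beta>] bexI[of _ \<alpha>]) auto
qed

theorem mainTheorem12:
  shows "(\<forall>\<alpha>\<in>{0<..<1::real}. \<forall>\<beta>\<in>{0<..<1::real}. \<forall>\<gamma>\<in>{0<..<1::real}. ln \<beta> / ln \<alpha> \<notin> \<rat> \<longrightarrow>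
            (\<exists>!F. is_attractor {0..1} (ifs \<alpha> \<beta> \<gamma>) F) \<and>
            (\<exists>!s::real. \<alpha> powr s + \<beta> powr s + \<gamma> powr s = 1) \<and>
            (\<forall>F. is_attractor {0..1} (ifs \<alpha> \<beta> \<gamma>) F \<longrightarrow>
               assouad_dim F = 1 \<and>
               (\<forall>s::real. \<alpha> powr s + \<beta> powr s + \<gamma> powr s = 1 \<and> s < 1 \<longrightarrow>
                  lower_dim F = hausdorff_dim F \<and>
                  hausdorff_dim F = lower_box_dim F \<and>
                  lower_box_dim F = upper_box_dim F \<and>
                  upper_box_dim F \<le> ereal s \<and>
                  ereal s < 1 \<and>
                  1 = assouad_dim F)))
       \<and> (\<forall>\<epsilon>>0. \<exists>\<alpha>\<in>{0<..<1::real}. \<exists>\<beta>\<in>{0<..<1::real}. \<exists>\<gamma>\<in>{0<..<1::real}. ln \<beta> / ln \<alpha> \<notin> \<rat> \<and>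
            (\<exists>s::real. \<alpha> powr s + \<beta> powr s + \<gamma> powr s = 1 \<and> s < \<epsilon>))"
proof (intro conjI ballI allI impI)
  fix \<alpha> \<beta> \<gamma> :: real
  assume "\<alpha> \<in> {0<..<1}" "\<beta> \<in> {0<..<1}" "\<gamma> \<in> {0<..<1}" and irrational: "ln \<beta> / ln \<alpha> \<notin> \<rat>"
  then have range: "0 < \<alpha>" "\<alpha> < 1" "0 < \<beta>" "\<beta> < 1" "0 < \<gamma>" "\<gamma> < 1" by auto
  show "\<exists>!F. is_attractor {0..1} (ifs \<alpha> \<beta> \<gamma>) F"
    using attractor_exists[OF range] attractor_subset_attractor[OF _ _ range] by blast
  show "\<exists>!s::real. \<alpha> powr s + \<beta> powr s + \<gamma> powr s = 1"
    using similarity_dim_exists[OF range] similarity_dim_unique[OF range] by blast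
  fix F assume F: "is_attractor {0..1} (ifs \<alpha> \<beta> \<gamma>) F"
  show A: "assouad_dim F = 1" by (rule assouad_dim_attractor[OF F range irrational])
  fix s :: real assume s: "\<alpha> powr s + \<beta> powr s + \<gamma> powr s = 1 \<and> s < 1"
  have "0 < Min {\<alpha>, \<beta>, \<gamma>}" "compact F" "F \<noteq> {}" using range F by (auto simp: is_attractor_def)
  note dims = dims_eq_of_copies_in_balls[OF attractor_has_copies_in_balls[OF F range] this]
  show "lower_dim F = hausdorff_dim F" "hausdorff_dim F = lower_box_dim F" "lower_box_dim F = upper_box_dim F"
    by (simp_all add: dims)
  show "upper_box_dim F \<le> ereal s" using hausdorff_dim_attractor_le[OF F range, of s] s by (simp add: dims)
  show "ereal s < 1" using s by (simp add: one_ereal_def)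
  show "1 = assouad_dim F" by (simp add: A)
qed (rule small_similarity_dim)

end
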